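(* For every fixed $x\in\mathbb{R}$ the limit $$\Psi_d(x)=\lim_{N\to+\infty}\frac{1}{V_d(N)}\#\left\{\lambda\in\mathcal{V}_d(N):\ \frac{\mathrm{rk}(\lambda)}{(6N/\pi^2)^{1/4}}\le x\right\}$$ exists and equals the standard normal distribution function: $$\Psi_d(x)=\frac{1}{\sqrt{2\pi}}\int_{-\infty}^{x}e^{-t^2/2}\,dt.$$
   Context: A strongly concave composition of a nonnegative integer $n$ is a finite sequence of nonnegative integers $(a_1,\dots,a_s)$, $s\ge 1$, summing to $n$, such that for some index $k$ with $1\le k\le s$ one has $a_1>a_2>\dots>a_{k-1}>a_k<a_{k+1}<\dots<a_s$; $a_k$ is called the central part. Its rank is $\mathrm{rk}(\lambda)=s-2k+1$. $\mathcal{V}_d(n)$ denotes the set of strongly concave compositions of $n$ and $V_d(n)=\#\mathcal{V}_d(n)$. *)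

theory Defs
  imports "HOL-Analysis.Analysis"
begin

text \<open>A list xs = [a_1,...,a_s] (0-indexed in Isabelle) is strongly concave with
  central index k (1-based, 1 <= k <= s) iff a_1 > ... > a_k < ... < a_s.\<close>
definition concave_at :: "nat list \<Rightarrow> nat \<Rightarrow> bool" where
  "concave_at xs k \<longleftrightarrow> 1 \<le> k \<and> k \<le> length xs \<and>
     (\<forall>i. i + 1 < k \<longrightarrow> xs ! i > xs ! (i + 1)) \<and>
     (\<forall>i. k - 1 \<le> i \<and> i + 1 < length xs \<longrightarrow> xs ! i < xs ! (i + 1))"

definition strongly_concave :: "nat list \<Rightarrow> bool" where
  "strongly_concave xs \<longleftrightarrow> xs \<noteq> [] \<and> (\<exists>k. concave_at xs k)"

definition Vd_set :: "nat \<Rightarrow> nat list set" where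
  "Vd_set n = {xs. strongly_concave xs \<and> sum_list xs = n}"

definition Vd :: "nat \<Rightarrow> nat" where
  "Vd n = card (Vd_set n)"

text \<open>Central index (unique, since the central part is the strict minimum).\<close>
definition central_index :: "nat list \<Rightarrow> nat" where
  "central_index xs = (THE k. concave_at xs k)"

definition rk :: "nat list \<Rightarrow> int" where
  "rk xs = int (length xs) - 2 * int (central_index xs) + 1"

end

theory Submission
  imports Defs "HOL-Probability.Probability" "HOL-Real_Asymp.Real_Asymp"
begin

text \<open>
  A strongly concave composition with central part \<open>c\<close> is a pair \<open>(L, R)\<close> of finite sets of integers
  larger than \<open>c\<close>, and its rank is \<open>card R - card L\<close>. With \<open>q = exp (- t)\<close>, \<open>t = pi / sqrt (6 N)\<close>, the
  product of \<open>(1 + exp (i \<alpha>) q^j) (1 + exp (- i \<alpha>) q^j)\<close> over \<open>j > c\<close> is, up to normalisation, the joint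
  characteristic function of independent Bernoulli variables deciding which \<open>j\<close> lie in \<open>L\<close> and in \<open>R\<close>.
  Its \<open>N\<close>-th coefficient is a Fourier integral. Scaling the frequency by the standard deviation of the
  total size and \<open>\<alpha> = x sqrt t\<close>, the integrand converges to a Gaussian
  \<open>exp (- (u^2 + x^2) / 2)\<close> (size and rank are uncorrelated by the symmetry \<open>L \<leftrightarrow> R\<close>, and \<open>t\<close> is chosen
  such that the mean size is \<open>N + o(t^(- 3/2))\<close>), and it is dominated by a multiple of \<open>1 / (1 + u^2)\<close>.
  Raising \<open>c\<close> by one divides the count by 4 asymptotically, and inserting \<open>c\<close> into \<open>L\<close> embeds the
  compositions with \<open>c > C\<close> into the pairs of total size \<open>N\<close> with all parts larger than \<open>C\<close>, so the sum over
  \<open>c\<close> converges uniformly in \<open>N\<close>. So the characteristic function of the scaled rank tends to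
  \<open>exp (- x^2 / 2)\<close>, and Levy's continuity theorem applies.
\<close>

section \<open>Compositions as pairs of sets\<close>

text \<open>A strictly monotone run is determined by its set of values, so the two flanks of a
  composition are stored as sets. \<open>n\<close> counts the flanks only, without the central part
  \<open>c\<close>.\<close>

definition pairs :: "nat \<Rightarrow> nat \<Rightarrow> (nat set \<times> nat set) set" where
  "pairs c n = {(L, R). finite L \<and> finite R \<and> L \<subseteq> {c<..} \<and> R \<subseteq> {c<..} \<and> \<Sum>L + \<Sum>R = n}"

definition rank_diff :: "nat set \<times> nat set \<Rightarrow> int" where
  "rank_diff p = int (card (snd p)) - int (card (fst p))"

definition comp_of :: "nat \<times> nat set \<times> nat set \<Rightarrow> nat list" where
  "comp_of = (\<lambda>(c, L, R). rev (sorted_list_of_set L) @ c # sorted_list_of_set R)"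

text \<open>No element of a finite set exceeds its sum, so cutting at any \<open>N\<close> at or
  above \<open>n\<close> loses nothing. The freedom in \<open>N\<close> lets sizes
  \<open>N - c\<close> be read off a product that runs up to \<open>N\<close>.\<close>

lemma pairs_eq:
  assumes "n \<le> N"
  shows "pairs c n = {p \<in> Pow {c<..N} \<times> Pow {c<..N}. \<Sum>(fst p) + \<Sum>(snd p) = n}"
proof -
  have "a \<le> n" if "finite A" "a \<in> A" "\<Sum>A \<le> n" for a :: nat and A
    using member_le_sum[of a A "\<lambda>a. a"] that by simp
  hence sub: "A \<subseteq> {c<..N}" if "finite A" "A \<subseteq> {c<..}" "\<Sum>A \<le> n" for A
    using that assms by force
  have iff: "finite A \<and> A \<subseteq> {c<..} \<longleftrightarrow> A \<subseteq> {c<..N}" if "\<Sum>A \<le> n" for A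
    using sub[of A] finite_subset[of A "{c<..N}"] that by auto
  have "p \<in> pairs c n \<longleftrightarrow> fst p \<subseteq> {c<..N} \<and> snd p \<subseteq> {c<..N} \<and> \<Sum>(fst p) + \<Sum>(snd p) = n" for p
    using iff[of "fst p"] iff[of "snd p"] unfolding pairs_def case_prod_beta mem_Collect_eq by linarith
  thus ?thesis by (simp add: set_eq_iff mem_Times_iff)
qed

lemma finite_pairs: "finite (pairs c n)"
  unfolding pairs_eq[OF order.refl] by (rule finite_subset[of _ "Pow {c<..n} \<times> Pow {c<..n}"]) auto

text \<open>The strict order is transitive, so inequalities between neighbours amount to sortedness.
  The centre \<open>c\<close> belongs to both lists, which covers the two comparisons next to
  it.\<close>

lemma concave_at_append:
  "concave_at (ys @ c # zs) (Suc (length ys)) \<longleftrightarrow> sorted_wrt (>) (ys @ [c]) \<and> sorted_wrt (<) (c # zs)"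
proof -
  have 1: "sorted_wrt (>) (ys @ [c]) \<longleftrightarrow> (\<forall>i. Suc i < Suc (length ys) \<longrightarrow> (ys @ c # zs) ! i > (ys @ c # zs) ! Suc i)"
    by (subst sorted_wrt_iff_nth_Suc_transp) (auto simp: transp_def nth_append)
  have "sorted_wrt (<) (c # zs) \<longleftrightarrow> (\<forall>i. Suc i < length (c # zs) \<longrightarrow> (c # zs) ! i < (c # zs) ! Suc i)"
    by (rule sorted_wrt_iff_nth_Suc_transp) (simp add: transp_def)
  also have "\<dots> \<longleftrightarrow> (\<forall>i. length ys \<le> i \<and> Suc i < length (ys @ c # zs) \<longrightarrow> (ys @ c # zs) ! i < (ys @ c # zs) ! Suc i)"
  proof safe
    fix i assume *: "\<forall>i. Suc i < length (c # zs) \<longrightarrow> (c # zs) ! i < (c # zs) ! Suc i"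
      and i: "length ys \<le> i" "Suc i < length (ys @ c # zs)"
    from i obtain k where "i = length ys + k" by (metis le_iff_add)
    thus "(ys @ c # zs) ! i < (ys @ c # zs) ! Suc i"
      using *[rule_format, of k] i by (simp add: nth_append Suc_diff_le)
  next
    fix i assume *: "\<forall>i. length ys \<le> i \<and> Suc i < length (ys @ c # zs) \<longrightarrow> (ys @ c # zs) ! i < (ys @ c # zs) ! Suc i"
      and i: "Suc i < length (c # zs)"
    show "(c # zs) ! i < (c # zs) ! Suc i"
      using *[rule_format, of "length ys + i"] i by (simp add: nth_append)
  qed
  finally show ?thesis using 1 by (auto simp: concave_at_def)
qed

lemma concave_at_split:
  assumes "concave_at xs k"
  obtains ys c zs where "xs = ys @ c # zs" "k = Suc (length ys)"
    "sorted_wrt (>) (ys @ [c])" "sorted_wrt (<) (c # zs)"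
proof -
  have k: "1 \<le> k" "k \<le> length xs" using assms by (auto simp: concave_at_def)
  hence xs: "xs = take (k - 1) xs @ xs ! (k - 1) # drop (Suc (k - 1)) xs"
    by (intro id_take_nth_drop) auto
  have l: "k = Suc (length (take (k - 1) xs))" using k by simp
  show ?thesis
    using that[OF xs l] concave_at_append[of "take (k - 1) xs" "xs ! (k - 1)" "drop (Suc (k - 1)) xs"]
      assms xs l by metis
qed

text \<open>Prepares uniqueness: two different central indices would each hold the strictly smaller
  entry. So \<open>THE\<close> in \<open>central_index\<close> is meaningful.\<close>

lemma concave_at_nth_min:
  assumes "concave_at xs k" "i < length xs" "i \<noteq> k - 1"
  shows "xs ! (k - 1) < xs ! i"
proof -
  obtain ys c zs where *: "xs = ys @ c # zs" "k = Suc (length ys)"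
    "sorted_wrt (>) (ys @ [c])" "sorted_wrt (<) (c # zs)"
    using concave_at_split[OF assms(1)] .
  have "xs ! i \<in> set ys \<union> set zs"
    using assms(2,3) * by (auto simp: nth_append nth_Cons split: nat.splits)
  thus ?thesis using * by (auto simp: sorted_wrt_append)
qed

lemma concave_at_unique:
  assumes "concave_at xs k" "concave_at xs k'"
  shows "k = k'"
proof (rule ccontr)
  assume "k \<noteq> k'"
  with assms have "k - 1 \<noteq> k' - 1" "k - 1 < length xs" "k' - 1 < length xs" by (auto simp: concave_at_def)
  with concave_at_nth_min[OF assms(1), of "k' - 1"] concave_at_nth_min[OF assms(2), of "k - 1"]
  show False by simp
qed

lemma concave_at_comp_of:
  assumes "(L, R) \<in> pairs c n"
  shows "concave_at (comp_of (c, L, R)) (Suc (card L))"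
proof -
  have fin: "finite L" "finite R" and sub: "L \<subseteq> {c<..}" "R \<subseteq> {c<..}"
    using assms by (auto simp: pairs_def)
  have "sorted_wrt (>) (rev (sorted_list_of_set L) @ [c])"
    using fin sub by (auto simp: sorted_wrt_append sorted_wrt_rev)
  moreover have "sorted_wrt (<) (c # sorted_list_of_set R)"
    using fin sub by auto
  ultimately show ?thesis
    using concave_at_append[of "rev (sorted_list_of_set L)" c "sorted_list_of_set R"]
    by (simp add: comp_of_def)
qed

lemma central_index_comp_of: "(L, R) \<in> pairs c n \<Longrightarrow> central_index (comp_of (c, L, R)) = Suc (card L)"
  unfolding central_index_def
  by (rule the_equality) (blast intro: concave_at_comp_of concave_at_unique)+

text \<open>With \<open>s = card L + 1 + card R\<close> and \<open>k = card L + 1\<close>, the rank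
  \<open>s - 2 k + 1\<close> collapses to \<open>card R - card L\<close>.\<close>

lemma rk_comp_of: "p \<in> pairs c n \<Longrightarrow> rk (comp_of (c, p)) = rank_diff p"
  using central_index_comp_of[of "fst p" "snd p" c n]
  by (auto simp: rk_def rank_diff_def comp_of_def split: prod.splits)

text \<open>The central index of the list reveals \<open>card L\<close>, hence where to cut the list
  into \<open>L\<close>, \<open>c\<close> and \<open>R\<close>.\<close>

lemma inj_on_comp_of: "inj_on comp_of (SIGMA c:{..n}. pairs c (n - c))"
proof (rule inj_onI, clarsimp)
  fix c L R c' L' R'
  assume a: "(L, R) \<in> pairs c (n - c)" "(L', R') \<in> pairs c' (n - c')"
    and eq: "comp_of (c, L, R) = comp_of (c', L', R')"
  have "card L = card L'" using central_index_comp_of[OF a(1)] central_index_comp_of[OF a(2)] eq by simp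
  hence "rev (sorted_list_of_set L) = rev (sorted_list_of_set L') \<and> c # sorted_list_of_set R = c' # sorted_list_of_set R'"
    using eq by (subst append_eq_append_conv[symmetric]) (auto simp: comp_of_def)
  thus "c = c' \<and> L = L' \<and> R = R'"
    using a by (auto simp: pairs_def dest: sorted_list_of_set_inject)
qed

lemma sum_list_sorted_list_of_set: "finite (A :: nat set) \<Longrightarrow> sum_list (sorted_list_of_set A) = \<Sum>A"
  by (metis distinct_sorted_list_of_set set_sorted_list_of_set distinct_sum_list_conv_Sum)

text \<open>Restricting \<open>c\<close> to values up to \<open>n\<close> keeps the truncated
  difference \<open>n - c\<close> a true one.\<close>

lemma Vd_set_eq: "Vd_set n = comp_of ` (SIGMA c:{..n}. pairs c (n - c))"
proof (intro equalityI subsetI)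
  fix xs assume "xs \<in> Vd_set n"
  then obtain k where k: "concave_at xs k" and n: "sum_list xs = n"
    by (auto simp: Vd_set_def strongly_concave_def)
  obtain ys c zs where *: "xs = ys @ c # zs" "k = Suc (length ys)"
    "sorted_wrt (>) (ys @ [c])" "sorted_wrt (<) (c # zs)"
    using concave_at_split[OF k] .
  have ys: "sorted_wrt (<) (rev ys)" using *(3) by (simp add: sorted_wrt_append sorted_wrt_rev)
  have zs: "sorted_wrt (<) zs" using *(4) by simp
  have L: "sorted_list_of_set (set ys) = rev ys"
    using sorted_list_of_set.idem_if_sorted_distinct[of "rev ys"] ys by (simp add: strict_sorted_iff)
  have R: "sorted_list_of_set (set zs) = zs"
    using sorted_list_of_set.idem_if_sorted_distinct[of zs] zs by (simp add: strict_sorted_iff)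
  have "xs = comp_of (c, set ys, set zs)" unfolding comp_of_def using L R *(1) by simp
  moreover have "\<Sum>(set ys) = sum_list ys" "\<Sum>(set zs) = sum_list zs"
    using ys zs by (auto simp: strict_sorted_iff distinct_sum_list_conv_Sum)
  hence "(set ys, set zs) \<in> pairs c (n - c)" "c \<le> n"
    using * n by (auto simp: pairs_def sorted_wrt_append)
  ultimately show "xs \<in> comp_of ` (SIGMA c:{..n}. pairs c (n - c))" by force
next
  fix xs assume "xs \<in> comp_of ` (SIGMA c:{..n}. pairs c (n - c))"
  then obtain c L R where *: "c \<le> n" "(L, R) \<in> pairs c (n - c)" "xs = comp_of (c, L, R)" by auto
  have "sum_list xs = n"
    using * by (auto simp: comp_of_def pairs_def sum_list_sorted_list_of_set)
  with concave_at_comp_of[OF *(2)] *(3) show "xs \<in> Vd_set n"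
    by (auto simp: Vd_set_def strongly_concave_def comp_of_def)
qed

lemma finite_Vd_set: "finite (Vd_set n)"
  unfolding Vd_set_eq using finite_pairs by auto

lemma Vd_set_nonempty: "Vd_set n \<noteq> {}"
proof -
  have "concave_at [n] 1" by (simp add: concave_at_def)
  hence "[n] \<in> Vd_set n" by (auto simp: Vd_set_def strongly_concave_def)
  thus ?thesis by blast
qed

lemma sum_Vd_set:
  fixes f :: "int \<Rightarrow> 'a :: comm_monoid_add"
  shows "(\<Sum>xs\<in>Vd_set n. f (rk xs)) = (\<Sum>c\<le>n. \<Sum>p\<in>pairs c (n - c). f (rank_diff p))"
proof -
  have "(\<Sum>xs\<in>Vd_set n. f (rk xs)) = (\<Sum>z\<in>(SIGMA c:{..n}. pairs c (n - c)). f (rk (comp_of z)))"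
    unfolding Vd_set_eq by (simp add: sum.reindex[OF inj_on_comp_of])
  also have "\<dots> = (\<Sum>z\<in>(SIGMA c:{..n}. pairs c (n - c)). f (rank_diff (snd z)))"
    by (intro sum.cong refl) (auto simp: rk_comp_of)
  also have "\<dots> = (\<Sum>c\<le>n. \<Sum>p\<in>pairs c (n - c). f (rank_diff p))"
    by (simp add: sum.Sigma finite_pairs split_beta)
  finally show ?thesis .
qed

text \<open>Insert \<open>c\<close> into \<open>L\<close>, where it is recovered as the minimum.\<close>
lemma card_pairs_tail:
  "(\<Sum>c\<in>{C<..n}. card (pairs c (n - c))) \<le> card (pairs C n)"
proof -
  let ?S = "SIGMA c:{C<..n}. pairs c (n - c)"
  let ?f = "\<lambda>(c, L, R). (insert c L, R :: nat set)"
  have Min: "Min (insert c L) = c" if "(L, R) \<in> pairs c m" for c L R m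
    using that by (intro Min_eqI) (auto simp: pairs_def)
  have "inj_on ?f ?S"
  proof (rule inj_onI, clarsimp)
    fix c L c' L' R
    assume a: "(L, R) \<in> pairs c (n - c)" "(L', R) \<in> pairs c' (n - c')" "insert c L = insert c' L'"
    have "c = c'" using Min[OF a(1)] Min[OF a(2)] a(3) by simp
    moreover have "c \<notin> L" "c' \<notin> L'" using a by (auto simp: pairs_def)
    ultimately show "c = c' \<and> L = L'" using a(3) by auto
  qed
  moreover have "?f ` ?S \<subseteq> pairs C n"
  proof (rule subsetI, clarsimp)
    fix c L R assume c: "C < c" "c \<le> n" and p: "(L, R) \<in> pairs c (n - c)"
    have "c \<notin> L" using p by (auto simp: pairs_def)
    hence "\<Sum>(insert c L) = c + \<Sum>L" using p by (simp add: pairs_def)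
    thus "(insert c L, R) \<in> pairs C n" using c p by (auto simp: pairs_def)
  qed
  ultimately have "card ?S \<le> card (pairs C n)" by (rule card_inj_on_le) (rule finite_pairs)
  thus ?thesis by (simp add: finite_pairs)
qed

section \<open>Characteristic functions of Bernoulli variables\<close>

definition bern_char :: "real \<Rightarrow> real \<Rightarrow> complex" where
  "bern_char p y = of_real (1 - p) + of_real p * cis y"

lemma norm_bern_char_power2: "(norm (bern_char p y))\<^sup>2 = 1 - 2 * p * (1 - p) * (1 - cos y)"
proof -
  have "(norm (bern_char p y))\<^sup>2 = (1 - p + p * cos y)\<^sup>2 + (p * sin y)\<^sup>2"
    by (simp add: bern_char_def cmod_power2)
  also have "\<dots> = (1 - p)\<^sup>2 + 2 * p * (1 - p) * cos y + p\<^sup>2 * ((sin y)\<^sup>2 + (cos y)\<^sup>2)"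
    by algebra
  also have "\<dots> = 1 - 2 * p * (1 - p) * (1 - cos y)"
    unfolding sin_cos_squared_add by algebra
  finally show ?thesis .
qed

text \<open>\<open>1 + v \<le> exp v\<close> applied to the squared modulus. The exponential form
  turns products of such factors into sums in the exponent.\<close>

lemma norm_bern_char_le: "norm (bern_char p y) \<le> exp (- (p * (1 - p) * (1 - cos y)))"
proof -
  let ?a = "p * (1 - p) * (1 - cos y)"
  have "(norm (bern_char p y))\<^sup>2 \<le> exp (- 2 * ?a)"
    unfolding norm_bern_char_power2 using exp_ge_add_one_self[of "- 2 * ?a"] by (simp add: algebra_simps)
  also have "\<dots> = (exp (- ?a))\<^sup>2"
    by (simp add: power2_eq_square flip: exp_add)
  finally show ?thesis
    by (rule power2_le_imp_le) simp
qed

lemma norm_bern_char_le_1: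
  assumes "0 \<le> p" "p \<le> 1"
  shows "norm (bern_char p y) \<le> 1"
proof -
  have "0 \<le> p * (1 - p) * (1 - cos y)" using assms by simp
  with norm_bern_char_le[of p y] show ?thesis by (meson exp_le_one_iff neg_le_0_iff_le order_trans)
qed

lemma norm_cis_taylor2: "norm (cis y - (1 + \<i> * y - y\<^sup>2 / 2)) \<le> \<bar>y\<bar> ^ 3 / 6"
proof -
  have "(\<Sum>k\<le>2. (\<i> * complex_of_real y) ^ k / fact k) = 1 + \<i> * y - y\<^sup>2 / 2"
    by (simp add: eval_nat_numeral power_mult_distrib)
  with iexp_approx1[of y 2] show ?thesis
    by (simp add: cis_conv_exp mult.commute eval_nat_numeral)
qed

text \<open>The centred variable takes the values \<open>- p\<close> and \<open>1 - p\<close>. On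
  expanding \<open>cis\<close> to second order at both, the linear terms cancel and the quadratic
  ones leave the variance \<open>p * (1 - p)\<close>. Each error term keeps a factor
  \<open>p\<close>, which later controls the sum of the errors over \<open>j\<close>.\<close>

lemma bern_char_centered_approx:
  assumes "0 \<le> p" "p \<le> 1"
  shows "norm (cis (- (p * y)) * bern_char p y - exp (- (p * (1 - p) * y\<^sup>2 / 2)))
           \<le> p * \<bar>y\<bar> ^ 3 / 3 + p * y ^ 4 / 4"
proof -
  define T where "T = (\<lambda>v::real. 1 + \<i> * v - of_real (v\<^sup>2 / 2) :: complex)"
  let ?s = "p * (1 - p) * y\<^sup>2 / 2"
  have eq: "cis (- (p * y)) * bern_char p y = (1 - p) * cis (- (p * y)) + p * cis ((1 - p) * y)"
    by (simp add: bern_char_def ring_distribs cis_mult mult.left_commute)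
  have T: "(1 - p) * T (- (p * y)) + p * T ((1 - p) * y) = of_real (1 - ?s)"
    by (simp add: T_def complex_eq_iff) algebra
  have s0: "0 \<le> ?s" using assms by simp
  have e1: "norm (cis (- (p * y)) - T (- (p * y))) \<le> p * \<bar>y\<bar> ^ 3 / 6"
  proof -
    have "norm (cis (- (p * y)) - T (- (p * y))) \<le> \<bar>- (p * y)\<bar> ^ 3 / 6"
      unfolding T_def by (rule norm_cis_taylor2)
    also have "\<dots> = p ^ 3 * \<bar>y\<bar> ^ 3 / 6" using assms by (simp add: abs_mult power_mult_distrib)
    also have "\<dots> \<le> p * \<bar>y\<bar> ^ 3 / 6"
      using power_decreasing[of 1 3 p] assms by (intro divide_right_mono mult_right_mono) auto
    finally show ?thesis .
  qed
  have e2: "norm (cis ((1 - p) * y) - T ((1 - p) * y)) \<le> \<bar>y\<bar> ^ 3 / 6"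
  proof -
    have "norm (cis ((1 - p) * y) - T ((1 - p) * y)) \<le> \<bar>(1 - p) * y\<bar> ^ 3 / 6"
      unfolding T_def by (rule norm_cis_taylor2)
    also have "\<dots> = (1 - p) ^ 3 * \<bar>y\<bar> ^ 3 / 6" using assms by (simp add: abs_mult power_mult_distrib)
    also have "\<dots> \<le> 1 * \<bar>y\<bar> ^ 3 / 6"
      using assms by (intro divide_right_mono mult_right_mono power_le_one) auto
    finally show ?thesis by simp
  qed
  \<comment> \<open>For nonnegative \<open>s\<close>, \<open>exp (- s)\<close> lies between
    \<open>1 - s\<close> and \<open>1 / (1 + s)\<close>, and the latter is at most
    \<open>1 - s + s^2\<close>.\<close>
  have e3: "\<bar>exp (- ?s) - (1 - ?s)\<bar> \<le> p * y ^ 4 / 4"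
  proof -
    have l: "1 - ?s \<le> exp (- ?s)" using exp_ge_add_one_self[of "- ?s"] by simp
    have "exp (- ?s) \<le> 1 / (1 + ?s)"
      unfolding exp_minus inverse_eq_divide
      using exp_ge_add_one_self[of ?s] s0 by (intro divide_left_mono) auto
    also have "\<dots> \<le> 1 - ?s + ?s\<^sup>2"
    proof -
      have "1 + 0 \<le> 1 + ?s ^ 3" using s0 by (intro add_left_mono zero_le_power)
      also have "1 + u ^ 3 = (1 - u + u\<^sup>2) * (1 + u)" for u :: real by algebra
      finally show ?thesis using s0 by (simp add: divide_le_eq)
    qed
    finally have "\<bar>exp (- ?s) - (1 - ?s)\<bar> \<le> ?s\<^sup>2" using l by linarith
    also have "?s\<^sup>2 = (p * (1 - p)\<^sup>2) * (p * y ^ 4 / 4)"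
      by (simp add: power2_eq_square eval_nat_numeral)
    also have "\<dots> \<le> 1 * (p * y ^ 4 / 4)"
      using assms by (intro mult_right_mono mult_le_one power_le_one) auto
    finally show ?thesis by simp
  qed
  have "cis (- (p * y)) * bern_char p y - exp (- ?s)
      = (1 - p) * (cis (- (p * y)) - T (- (p * y))) + p * (cis ((1 - p) * y) - T ((1 - p) * y))
        - of_real (exp (- ?s) - (1 - ?s))"
    unfolding eq using T by (simp add: algebra_simps)
  also have "norm \<dots> \<le> (1 - p) * (p * \<bar>y\<bar> ^ 3 / 6) + p * (\<bar>y\<bar> ^ 3 / 6) + p * y ^ 4 / 4"
  proof (intro norm_triangle_le_diff add_mono norm_triangle_le)
    show "norm ((1 - p) * (cis (- (p * y)) - T (- (p * y)))) \<le> (1 - p) * (p * \<bar>y\<bar> ^ 3 / 6)"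
      unfolding norm_mult norm_of_real using e1 assms by (intro mult_mono) auto
    show "norm (p * (cis ((1 - p) * y) - T ((1 - p) * y))) \<le> p * (\<bar>y\<bar> ^ 3 / 6)"
      unfolding norm_mult norm_of_real using e2 assms by (intro mult_mono) auto
    show "norm (complex_of_real (exp (- ?s) - (1 - ?s))) \<le> p * y ^ 4 / 4"
      using e3 by (simp only: norm_of_real)
  qed
  also have "(1 - p) * (p * \<bar>y\<bar> ^ 3 / 6) \<le> 1 * (p * \<bar>y\<bar> ^ 3 / 6)"
    using assms by (intro mult_right_mono) auto
  finally show ?thesis by (simp add: field_simps)
qed

section \<open>Exponentially damped power sums\<close>

lemma power_div_fact_le_exp:
  fixes x :: real
  assumes "0 \<le> x"
  shows "x ^ k / fact k \<le> exp x"
proof -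
  have s: "(\<lambda>n. x ^ n /\<^sub>R fact n) sums exp x" by (rule exp_converges)
  have "sum (\<lambda>n. x ^ n /\<^sub>R fact n) {k} \<le> suminf (\<lambda>n. x ^ n /\<^sub>R fact n)"
    using assms sums_summable[OF s] by (intro sum_le_suminf) auto
  thus ?thesis using sums_unique[OF s] by (simp add: field_simps)
qed

text \<open>Half of the exponential absorbs \<open>j ^ k\<close> through
  \<open>x ^ k / fact k \<le> exp x\<close>; the other half is summed as a geometric series. The
  order in \<open>t\<close> is that of the integral of \<open>x ^ k * exp (- t x)\<close> over the
  half line.\<close>

lemma sum_power_mult_exp_le:
  assumes "0 < t"
  shows "(\<Sum>j=1..N. real j ^ k * exp (- (t * real j))) \<le> fact k * 2 ^ (k + 1) / t ^ (k + 1)"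
proof -
  let ?q = "exp (- (t / 2))"
  have q: "0 < ?q" "?q < 1" using assms by auto
  have term_le: "real j ^ k * exp (- (t * real j)) \<le> fact k * (2 / t) ^ k * ?q ^ j" for j
  proof -
    have "(t * j / 2) ^ k / fact k \<le> exp (t * j / 2)"
      using assms by (intro power_div_fact_le_exp) simp
    hence "real j ^ k \<le> fact k * (2 / t) ^ k * exp (t * j / 2)"
      using assms by (simp add: field_simps power_divide power_mult_distrib)
    hence "real j ^ k * exp (- (t * real j)) \<le> fact k * (2 / t) ^ k * exp (t * j / 2) * exp (- (t * real j))"
      by (rule mult_right_mono) simp
    also have "\<dots> = fact k * (2 / t) ^ k * ?q ^ j"
      by (simp add: mult.assoc flip: exp_add exp_of_nat_mult)
    finally show ?thesis .
  qed
  have geo: "(\<Sum>j=1..N. ?q ^ j) \<le> 2 / t"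
  proof -
    have "(\<Sum>j=1..N. ?q ^ j) = (\<Sum>j<N. ?q ^ Suc j)"
      by (rule sum.reindex_bij_witness[of _ Suc "\<lambda>j. j - 1"]) auto
    also have "\<dots> = ?q * ((1 - ?q ^ N) / (1 - ?q))"
      using q by (simp add: sum_gp_strict flip: sum_distrib_left)
    also have "\<dots> \<le> ?q * (1 / (1 - ?q))"
      using q by (intro mult_left_mono divide_right_mono) auto
    also have "\<dots> = 1 / (exp (t / 2) - 1)"
      using q by (simp add: exp_minus field_simps)
    also have "\<dots> \<le> 1 / (t / 2)"
      using assms exp_ge_add_one_self[of "t / 2"] by (intro divide_left_mono) (auto simp del: exp_ge_add_one_self)
    finally show ?thesis by simp
  qed
  have "(\<Sum>j=1..N. real j ^ k * exp (- (t * real j))) \<le> (\<Sum>j=1..N. fact k * (2 / t) ^ k * ?q ^ j)"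
    by (intro sum_mono term_le)
  also have "\<dots> = fact k * (2 / t) ^ k * (\<Sum>j=1..N. ?q ^ j)"
    by (simp add: sum_distrib_left)
  also have "\<dots> \<le> fact k * (2 / t) ^ k * (2 / t)"
    using assms by (intro mult_left_mono geo) auto
  finally show ?thesis by (simp add: power_divide mult_ac)
qed

section \<open>Mean and variance at the saddle point\<close>

text \<open>The saddle point; its square root is the reciprocal of the scale \<open>(6 N / pi^2) powr (1/4)\<close> of the rank.\<close>
definition temp :: "nat \<Rightarrow> real" where
  "temp N = pi / sqrt (6 * real N)"

text \<open>The probability that \<open>j\<close> belongs to \<open>L\<close> (equivalently, to \<open>R\<close>) in the Bernoulli model.\<close>
definition occ :: "real \<Rightarrow> nat \<Rightarrow> real" where
  "occ t j = exp (- (t * real j)) / (1 + exp (- (t * real j)))"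

lemma temp_pos: "0 < N \<Longrightarrow> 0 < temp N"
  by (simp add: temp_def)

lemma temp_sq_mult: "0 < N \<Longrightarrow> (temp N)\<^sup>2 * real N = pi\<^sup>2 / 6"
  by (simp add: temp_def power_divide)

lemma temp_at_right_0: "filterlim temp (at_right 0) sequentially"
  unfolding temp_def by real_asymp

lemma occ_bounds: "0 \<le> occ t j" "occ t j \<le> 1" "occ t j \<le> exp (- (t * real j))"
  using frac_le[of "exp (- (t * real j))" "exp (- (t * real j))" 1 "1 + exp (- (t * real j))"]
  by (auto simp: occ_def add_pos_pos divide_le_eq)

lemma one_minus_occ: "1 - occ t j = 1 / (1 + exp (- (t * real j)))"
proof -
  have "0 < 1 + exp (- (t * real j))" by (intro add_pos_pos) auto
  thus ?thesis by (simp add: occ_def field_simps)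
qed

text \<open>This is the derivative of the logistic function at \<open>t * real j\<close>, in a form
  whose monotonicity for nonnegative arguments is visible.\<close>

lemma occ_mult_one_minus: "occ t j * (1 - occ t j) = 1 / (2 + 2 * cosh (t * real j))"
proof -
  define e where "e = exp (t * real j)"
  have e: "0 < e" "exp (- (t * real j)) = 1 / e" by (auto simp: e_def exp_minus field_simps)
  have "occ t j * (1 - occ t j) = 1 / (2 + (e + 1 / e))"
  proof -
    have "occ t j = 1 / (e + 1)" "1 - occ t j = e / (e + 1)"
      unfolding one_minus_occ occ_def e(2) using e(1) by (auto simp: field_simps add_pos_pos)
    moreover have "2 + (e + 1 / e) = (e + 1) * (e + 1) / e" using e(1) by (simp add: field_simps)
    ultimately show ?thesis using e(1) by simp
  qed
  thus ?thesis by (simp add: cosh_def e(2) flip: e_def)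
qed

text \<open>With \<open>e = exp (- (t * real j))\<close> the variance is
  \<open>e / (1 + e)^2\<close>, and the denominator lies between 1 and 4 when \<open>t\<close> is
  nonnegative.\<close>

lemma occ_var_bounds:
  "0 \<le> occ t j * (1 - occ t j)" "occ t j * (1 - occ t j) \<le> exp (- (t * real j))"
  "0 \<le> t \<Longrightarrow> exp (- (t * real j)) / 4 \<le> occ t j * (1 - occ t j)"
proof -
  show "0 \<le> occ t j * (1 - occ t j)" using occ_bounds[of t j] by simp
  have "occ t j * (1 - occ t j) \<le> occ t j * 1"
    using occ_bounds[of t j] by (intro mult_left_mono) auto
  with occ_bounds(3)[of t j] show "occ t j * (1 - occ t j) \<le> exp (- (t * real j))" by simp
  assume "0 \<le> t"
  hence "exp (- (t * real j)) \<le> 1" by simp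
  hence "(1 + exp (- (t * real j))) * (1 + exp (- (t * real j))) \<le> 2 * 2"
    by (intro mult_mono) auto
  moreover have "0 < 1 + exp (- (t * real j))" by (intro add_pos_pos) auto
  ultimately have "exp (- (t * real j)) / (2 * 2) \<le> exp (- (t * real j)) / ((1 + exp (- (t * real j))) * (1 + exp (- (t * real j))))"
    by (intro divide_left_mono) auto
  thus "exp (- (t * real j)) / 4 \<le> occ t j * (1 - occ t j)"
    unfolding one_minus_occ by (simp add: occ_def)
qed

text \<open>For \<open>0 < y < 1\<close>, the case of interest, the first factor on the right is the
  sum of the whole series and the second records the loss from cutting at \<open>N\<close>.\<close>

lemma sum_nat_mult_power:
  fixes y :: real
  assumes "y \<noteq> 1"
  shows "(\<Sum>j=1..N. real j * y ^ j) = (y / (1 - y)\<^sup>2) * (1 - y ^ N * (1 + real N * (1 - y)))"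
proof (induction N)
  case (Suc N)
  have "(\<Sum>j=1..Suc N. real j * y ^ j) = (\<Sum>j=1..N. real j * y ^ j) + real (Suc N) * y ^ Suc N"
    by simp
  also have "\<dots> = (y / (1 - y)\<^sup>2) * (1 - y ^ N * (1 + real N * (1 - y))) + real (Suc N) * y ^ Suc N"
    unfolding Suc.IH ..
  also have "\<dots> = (y / (1 - y)\<^sup>2) * (1 - y ^ Suc N * (1 + real (Suc N) * (1 - y)))"
    using assms by (simp add: divide_simps) algebra
  finally show ?case .
qed simp

text \<open>The left side is \<open>1 / (2 * sinh (s / 2))^2\<close>, so the claim amounts to
  \<open>s / 2 \<le> sinh (s / 2)\<close>.\<close>

lemma exp_ratio_le_inverse_square:
  fixes s :: real
  assumes "0 < s"
  shows "exp (- s) / (1 - exp (- s))\<^sup>2 \<le> 1 / s\<^sup>2"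
proof -
  have "s / 2 \<le> sinh (s / 2)"
  proof -
    define x where "x = s / 2"
    \<comment> \<open>\<open>w\<close> is the quadratic Taylor minorant of \<open>exp x\<close>. It
      suffices because \<open>w^2 - 1 - 2 x w\<close> is \<open>x^4 / 4\<close>, hence
      nonnegative.\<close>
    define w where "w = 1 + x + x\<^sup>2 / 2"
    have x: "0 < x" using assms by (simp add: x_def)
    have w: "0 < w" unfolding w_def using x by (intro add_pos_pos) auto
    have ge: "w \<le> exp x" unfolding w_def using x by (intro exp_lower_Taylor_quadratic) auto
    hence "exp (- x) \<le> 1 / w"
      unfolding exp_minus inverse_eq_divide using w by (intro divide_left_mono) auto
    moreover have "2 * x \<le> w - 1 / w"
    proof -
      have "w\<^sup>2 - 1 - 2 * x * w = (x\<^sup>2)\<^sup>2 / 4"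
        by (simp add: w_def power2_eq_square field_simps)
      moreover have "0 \<le> (x\<^sup>2)\<^sup>2 / 4" by simp
      ultimately have "1 + 2 * x * w \<le> w\<^sup>2" by linarith
      thus ?thesis using w by (simp add: field_simps power2_eq_square)
    qed
    ultimately show ?thesis using ge by (simp add: sinh_def x_def)
  qed
  hence "s\<^sup>2 \<le> (2 * sinh (s / 2))\<^sup>2" using assms by (intro power_mono) auto
  also have "\<dots> = (1 - exp (- s))\<^sup>2 / exp (- s)"
  proof -
    have *: "exp s = (exp (s / 2))\<^sup>2" by (simp flip: exp_double)
    show ?thesis by (simp add: sinh_def exp_minus * field_simps power2_eq_square)
  qed
  finally show ?thesis using assms by (simp add: field_simps)
qed

text \<open>Two errors occur: \<open>1 - Q\<close> for replacing the whole series by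
  \<open>1 / s^2\<close>, and \<open>w\<close> for the cut at \<open>N\<close>. The former is at
  most both \<open>s\<close> and 1, hence at most any power of \<open>s\<close> with exponent in
  \<open>[0, 1]\<close>. The exponent 2/3 is below 1, so that the errors at
  \<open>s = t (k + 1)\<close>, divided by \<open>(k + 1)^2\<close>, can be summed over
  \<open>k\<close>, and above 1/2, so that the total vanishes even after division by
  \<open>sqrt t\<close>.\<close>

lemma nat_exp_sum_approx:
  assumes "0 < s" "0 < N"
  shows "\<bar>1 - s\<^sup>2 * (\<Sum>j=1..N. real j * exp (- (s * real j)))\<bar> \<le> s powr (2/3) + 2 / (real N * s)"
proof -
  define y where "y = exp (- s)"
  define Q where "Q = s\<^sup>2 * (y / (1 - y)\<^sup>2)"
  define w where "w = y ^ N * (1 + real N * (1 - y))"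
  have y: "0 < y" "y < 1" "1 - y \<le> s" "1 - s \<le> y"
    using assms exp_ge_add_one_self[of "- s"] by (auto simp: y_def simp del: exp_ge_add_one_self)
  have sum: "s\<^sup>2 * (\<Sum>j=1..N. real j * exp (- (s * real j))) = Q * (1 - w)"
    using sum_nat_mult_power[of y N] y
    by (simp add: Q_def w_def y_def mult_ac flip: exp_of_nat_mult)
  have Q1: "Q \<le> 1"
    using exp_ratio_le_inverse_square[OF assms(1)] assms by (simp add: Q_def y_def field_simps)
  have Q2: "1 - s \<le> Q"
  proof -
    have "(1 - y)\<^sup>2 \<le> s\<^sup>2" using y by (intro power_mono) auto
    hence "1 \<le> s\<^sup>2 / (1 - y)\<^sup>2" using y by (simp add: le_divide_eq)
    hence "y * 1 \<le> y * (s\<^sup>2 / (1 - y)\<^sup>2)" using y by (intro mult_left_mono) auto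
    with y show ?thesis by (simp add: Q_def mult_ac)
  qed
  have Q3: "0 \<le> Q" using y by (simp add: Q_def)
  have Q4: "1 - Q \<le> s powr (2/3)"
  proof (cases "s \<le> 1")
    case True
    hence "s powr 1 \<le> s powr (2/3)" using assms by (intro powr_mono') auto
    thus ?thesis using Q2 assms by simp
  next
    case False
    hence "1 \<le> s powr (2/3)" by (intro ge_one_powr_ge_zero) auto
    thus ?thesis using Q3 by simp
  qed
  have w0: "0 \<le> w" using y by (simp add: w_def)
  have w1: "w \<le> 2 / (real N * s)"
  proof -
    define v where "v = real N * s"
    have v: "0 < v" using assms by (simp add: v_def)
    have yN: "y ^ N = exp (- v)" by (simp add: y_def v_def flip: exp_of_nat_mult)
    have "w \<le> exp (- v) * (1 + v)"
      unfolding w_def yN v_def using y by (intro mult_left_mono add_left_mono) auto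
    also have "\<dots> = (1 + v) / exp v" by (simp add: exp_minus field_simps)
    also have "\<dots> \<le> (1 + v) / (1 + v + v\<^sup>2 / 2)"
      using v exp_lower_Taylor_quadratic[of v] by (intro divide_left_mono) (auto intro!: mult_pos_pos add_pos_pos)
    also have "\<dots> \<le> 2 / v"
    proof -
      have "(1 + v) * v \<le> 2 * (1 + v + v\<^sup>2 / 2)" using v by (simp add: power2_eq_square algebra_simps)
      moreover have "0 < 1 + v + v\<^sup>2 / 2" using v by (intro add_pos_pos) auto
      ultimately show ?thesis using v by (simp add: divide_le_eq le_divide_eq)
    qed
    finally show ?thesis by (simp add: v_def)
  qed
  have "Q * w \<le> 1 * w" using Q1 w0 by (intro mult_right_mono) auto
  moreover have "0 \<le> Q * w" using Q3 w0 by simp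
  ultimately show ?thesis unfolding sum using Q1 Q4 w1 assms
    by (simp add: abs_if algebra_simps)
qed

text \<open>
  Expanding the geometric series in \<open>exp (- t j)\<close> and summing over \<open>j\<close> first turns the sum into
  a perturbation of \<open>\<Sum>k. 1 / k^2\<close>.
\<close>
lemma bose_sum_approx:
  assumes "0 < t" "0 < N"
  shows "\<bar>pi\<^sup>2 / 6 - t\<^sup>2 * (\<Sum>j=1..N. real j / (exp (t * real j) - 1))\<bar>
          \<le> t powr (2/3) * (\<Sum>k. 1 / real (k + 1) powr (4/3)) + pi\<^sup>2 / 6 * (2 / (real N * t))"
proof -
  define D where "D = (\<lambda>k. \<Sum>j=1..N. real j * exp (- (t * real (k + 1) * real j)))"
  have D: "D sums (\<Sum>j=1..N. real j / (exp (t * real j) - 1))"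
    unfolding D_def
  proof (rule sums_sum)
    fix j assume j: "j \<in> {1..N}"
    let ?y = "exp (- (t * real j))"
    have "(\<lambda>k. ?y ^ k) sums (1 / (1 - ?y))"
      using assms j by (intro geometric_sums) auto
    hence "(\<lambda>k. real j * ?y * ?y ^ k) sums (real j * ?y * (1 / (1 - ?y)))"
      by (rule sums_mult)
    moreover have "real j * ?y * (1 / (1 - ?y)) = real j / (exp (t * real j) - 1)"
      using assms j by (simp add: exp_minus field_simps)
    moreover have "real j * ?y * ?y ^ k = real j * exp (- (t * real (k + 1) * real j))" for k
      by (simp add: algebra_simps flip: exp_add exp_of_nat_mult)
    ultimately show "(\<lambda>k. real j * exp (- (t * real (k + 1) * real j))) sums (real j / (exp (t * real j) - 1))"
      by simp
  qed
  have Z: "summable (\<lambda>k. 1 / real (k + 1) powr (4/3))"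
  proof -
    have "summable (\<lambda>k. real k powr (- (4/3)))" by (simp add: summable_real_powr_iff)
    hence "summable (\<lambda>k. real (k + 1) powr (- (4/3)))" by (subst summable_iff_shift)
    thus ?thesis by (simp add: powr_minus_divide)
  qed
  have diff: "(\<lambda>k. 1 / (real k + 1)\<^sup>2 - t\<^sup>2 * D k) sums (pi\<^sup>2 / 6 - t\<^sup>2 * (\<Sum>j=1..N. real j / (exp (t * real j) - 1)))"
    using sums_diff[OF inverse_squares_sums sums_mult[OF D, of "t\<^sup>2"]] by (simp add: add.commute)
  have bound_sums: "(\<lambda>k. t powr (2/3) * (1 / real (k + 1) powr (4/3)) + 1 / (real k + 1)\<^sup>2 * (2 / (real N * t)))
     sums (t powr (2/3) * (\<Sum>k. 1 / real (k + 1) powr (4/3)) + pi\<^sup>2 / 6 * (2 / (real N * t)))"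
    using sums_add[OF sums_mult[OF summable_sums[OF Z], of "t powr (2/3)"]
        sums_mult2[OF inverse_squares_sums, of "2 / (real N * t)"]] by (simp add: add_ac)
  have bound: "\<bar>1 / (real k + 1)\<^sup>2 - t\<^sup>2 * D k\<bar> \<le>
      t powr (2/3) * (1 / real (k + 1) powr (4/3)) + 1 / (real k + 1)\<^sup>2 * (2 / (real N * t))" for k
  proof -
    define s where "s = t * real (k + 1)"
    have s: "0 < s" "t \<le> s" using assms by (auto simp: s_def)
    \<comment> \<open>Here \<open>4/3 = 2 - 2/3\<close>: the factor \<open>s powr (2/3)\<close> uses
      up part of the decay of \<open>1 / (k + 1)^2\<close>.\<close>
    have pw: "1 / (real k + 1)\<^sup>2 * s powr (2/3) = t powr (2/3) * (1 / real (k + 1) powr (4/3))"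
    proof -
      have "real (k + 1) powr (2/3) * real (k + 1) powr (4/3) = (real k + 1)\<^sup>2"
        by (simp add: powr_numeral add.commute flip: powr_add)
      moreover have "s powr (2/3) = t powr (2/3) * real (k + 1) powr (2/3)"
        unfolding s_def by (rule powr_mult)
      ultimately show ?thesis by (simp add: divide_simps mult_ac)
    qed
    have "\<bar>1 / (real k + 1)\<^sup>2 - t\<^sup>2 * D k\<bar> = 1 / (real k + 1)\<^sup>2 * \<bar>1 - s\<^sup>2 * D k\<bar>"
    proof -
      have "1 / (real k + 1)\<^sup>2 - t\<^sup>2 * D k = 1 / (real k + 1)\<^sup>2 * (1 - s\<^sup>2 * D k)"
      proof -
        have "s\<^sup>2 = t\<^sup>2 * (real k + 1)\<^sup>2" by (simp add: s_def power_mult_distrib add.commute)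
        thus ?thesis by (simp add: field_simps)
      qed
      thus ?thesis by (simp add: abs_mult)
    qed
    also have "\<dots> \<le> 1 / (real k + 1)\<^sup>2 * (s powr (2/3) + 2 / (real N * s))"
      using nat_exp_sum_approx[OF s(1) assms(2)] by (intro mult_left_mono) (auto simp: D_def s_def)
    also have "\<dots> \<le> 1 / (real k + 1)\<^sup>2 * (s powr (2/3) + 2 / (real N * t))"
      using assms s by (intro mult_left_mono add_left_mono divide_left_mono) auto
    also have "\<dots> = t powr (2/3) * (1 / real (k + 1) powr (4/3)) + 1 / (real k + 1)\<^sup>2 * (2 / (real N * t))"
      by (simp only: distrib_left pw)
    finally show ?thesis .
  qed
  show ?thesis
    using sums_le[OF _ diff bound_sums] sums_le[OF _ sums_minus[OF diff] bound_sums] bound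
    by (smt (verit))
qed

text \<open>The standard deviation of the total size has order \<open>temp N powr (- (3/2))\<close>,
  so the mean misses \<open>N\<close> by a negligible fraction of it. The mean is expressed through
  the sums \<open>B t\<close>, which are close to \<open>pi^2 / (6 t^2)\<close>.\<close>

lemma occ_mean_asymp:
  "(\<lambda>N. temp N powr (3/2) * (2 * (\<Sum>j=1..N. real j * occ (temp N) j) - real N)) \<longlonglongrightarrow> 0"
proof -
  define Z where "Z = (\<Sum>k. 1 / real (k + 1) powr (4/3))"
  define E where "E = (\<lambda>t::real. 2 * (t powr (2/3) * Z + 2 * t) + ((2 * t) powr (2/3) * Z + t))"
  have "((\<lambda>t. t powr (- (1/2)) * E t) \<longlongrightarrow> 0) (at_right 0)"
    unfolding E_def by real_asymp
  hence lim: "(\<lambda>N. temp N powr (- (1/2)) * E (temp N)) \<longlonglongrightarrow> 0"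
    using temp_at_right_0 by (rule filterlim_compose)
  have "\<bar>temp N powr (3/2) * (2 * (\<Sum>j=1..N. real j * occ (temp N) j) - real N)\<bar>
        \<le> temp N powr (- (1/2)) * E (temp N)" if N: "0 < N" for N
  proof -
    define t where "t = temp N"
    have t: "0 < t" using temp_pos[OF N] by (simp add: t_def)
    define B where "B = (\<lambda>t. \<Sum>j=1..N. real j / (exp (t * real j) - 1))"
    have tN: "t\<^sup>2 * real N = pi\<^sup>2 / 6" using temp_sq_mult[OF N] by (simp add: t_def)
    hence tN': "pi\<^sup>2 / 6 * (2 / (real N * t)) = 2 * t"
      using t N by (simp add: field_simps power2_eq_square)
    hence tN2: "pi\<^sup>2 / 6 * (2 / (real N * (2 * t))) = t" by simp
    \<comment> \<open>\<open>1 / (y + 1) = 1 / (y - 1) - 2 / (y^2 - 1)\<close> avoids alternating series\<close>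
    have "(\<Sum>j=1..N. real j * occ t j) = B t - 2 * B (2 * t)"
      unfolding B_def sum_distrib_left sum_subtractf[symmetric]
    proof (intro sum.cong refl)
      fix j assume j: "j \<in> {1..N}"
      define x where "x = exp (t * real j)"
      have x: "1 < x" using j t by (simp add: x_def)
      have x2: "exp (2 * t * real j) = x\<^sup>2" by (simp add: x_def mult.assoc exp_double)
      have x3: "exp (- (t * real j)) = 1 / x" by (simp add: x_def exp_minus field_simps)
      have "x\<^sup>2 - 1 = (x - 1) * (x + 1)" by algebra
      thus "real j * occ t j = real j / (exp (t * real j) - 1) - 2 * (real j / (exp (2 * t * real j) - 1))"
        unfolding occ_def x2 x3 x_def[symmetric] using x by (simp add: divide_simps) (simp add: algebra_simps)
    qed
    hence "t\<^sup>2 * (2 * (\<Sum>j=1..N. real j * occ t j) - real N) = t\<^sup>2 * (2 * (B t - 2 * B (2 * t))) - t\<^sup>2 * real N"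
      by (simp only: right_diff_distrib)
    \<comment> \<open>\<open>4 * t^2 * B (2 t)\<close> is \<open>(2 t)^2 * B (2 t)\<close>, so the
      main terms add up to \<open>2 - 1\<close> times \<open>pi^2 / 6\<close>, which is exactly
      \<open>t^2 * N\<close>.\<close>
    also have "\<dots> = (pi\<^sup>2 / 6 - (2 * t)\<^sup>2 * B (2 * t)) + 2 * (t\<^sup>2 * B t - pi\<^sup>2 / 6)"
      unfolding tN by (simp add: algebra_simps power2_eq_square)
    also have "\<bar>\<dots>\<bar> \<le> E t"
    proof -
      have "\<bar>pi\<^sup>2 / 6 - t\<^sup>2 * B t\<bar> \<le> t powr (2/3) * Z + 2 * t"
        using bose_sum_approx[OF t N] unfolding tN' by (simp only: B_def Z_def)
      moreover have "\<bar>pi\<^sup>2 / 6 - (2 * t)\<^sup>2 * B (2 * t)\<bar> \<le> (2 * t) powr (2/3) * Z + t"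
        using bose_sum_approx[of "2 * t" N] t N unfolding tN2 by (simp only: B_def Z_def)
      moreover have "\<bar>c - v + 2 * (u - c)\<bar> \<le> 2 * a + b" if "\<bar>c - u\<bar> \<le> a" "\<bar>c - v\<bar> \<le> b" for c u v a b :: real
        using that unfolding abs_le_iff by (auto simp: algebra_simps)
      ultimately show ?thesis unfolding E_def by blast
    qed
    finally have le: "\<bar>t\<^sup>2 * (2 * (\<Sum>j=1..N. real j * occ t j) - real N)\<bar> \<le> E t" .
    have "t powr (3/2) = t powr (- (1/2)) * t\<^sup>2"
      using t by (simp flip: powr_numeral powr_add)
    hence "\<bar>t powr (3/2) * (2 * (\<Sum>j=1..N. real j * occ t j) - real N)\<bar>
      = t powr (- (1/2)) * \<bar>t\<^sup>2 * (2 * (\<Sum>j=1..N. real j * occ t j) - real N)\<bar>"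
      by (simp add: abs_mult)
    also have "\<dots> \<le> t powr (- (1/2)) * E t" using le by (intro mult_left_mono) auto
    finally show ?thesis by (simp add: t_def)
  qed
  hence "\<forall>\<^sub>F N in sequentially. norm (temp N powr (3/2) * (2 * (\<Sum>j=1..N. real j * occ (temp N) j) - real N))
        \<le> temp N powr (- (1/2)) * E (temp N)"
    by (intro eventually_sequentiallyI[of 1]) auto
  thus ?thesis using lim by (rule Lim_null_comparison)
qed

text \<open>A Riemann sum for the integral of \<open>g'\<close>, the derivative of the logistic
  function \<open>g\<close>, over \<open>[0, t N]\<close>. As \<open>g'\<close> decreases there, the
  mean value theorem places each term between two neighbouring increments of \<open>g\<close>, and
  these telescope. Since \<open>temp N * N\<close> tends to infinity, both bounds tend to
  \<open>1 - g 0 = 1 / 2\<close>.\<close>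

lemma sum_occ_var_asymp:
  "(\<lambda>N. temp N * (\<Sum>j=1..N. occ (temp N) j * (1 - occ (temp N) j))) \<longlonglongrightarrow> 1 / 2"
proof -
  define g where "g = (\<lambda>u::real. 1 / (1 + exp (- u)))"
  define g' where "g' = (\<lambda>u::real. 1 / (2 + 2 * cosh u))"
  have g': "(g has_real_derivative g' u) (at u)" for u
  proof -
    define e where "e = exp (- u)"
    have e: "0 < e" "exp u = 1 / e" by (auto simp: e_def exp_minus field_simps)
    have "1 + e \<noteq> 0" using e by simp
    hence "(g has_real_derivative e / (1 + e)\<^sup>2) (at u)"
      unfolding g_def e_def by (auto intro!: derivative_eq_intros simp: power2_eq_square)
    moreover have "g' u = e / (1 + e)\<^sup>2"
    proof -
      have "2 + 2 * cosh u = (1 + e)\<^sup>2 / e"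
        unfolding cosh_def e(2) e_def[symmetric] using e by (simp add: field_simps power2_eq_square)
      thus ?thesis by (simp add: g'_def)
    qed
    ultimately show ?thesis by simp
  qed
  have g'_anti: "g' b \<le> g' a" if "0 \<le> a" "a \<le> b" for a b
    unfolding g'_def using that
    by (intro divide_left_mono add_left_mono mult_left_mono) (auto simp: cosh_real_nonneg_le_iff add_pos_pos)
  have upper: "t * g' (t * real (Suc j)) \<le> g (t * real (Suc j)) - g (t * real j)" 
   and lower: "g (t * real (Suc (Suc j))) - g (t * real (Suc j)) \<le> t * g' (t * real (Suc j))" if t: "0 < t" for t j
  proof -
    obtain z where z: "t * real j < z" "z < t * real (Suc j)"
       "g (t * real (Suc j)) - g (t * real j) = (t * real (Suc j) - t * real j) * g' z"
      using MVT2[of "t * real j" "t * real (Suc j)" g g'] g' t by auto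
    have "0 \<le> t * real j" using t by simp
    hence "g' (t * real (Suc j)) \<le> g' z" using z by (intro g'_anti) linarith+
    thus "t * g' (t * real (Suc j)) \<le> g (t * real (Suc j)) - g (t * real j)"
      using z(3) t by (simp add: algebra_simps)
    obtain z where z: "t * real (Suc j) < z" "z < t * real (Suc (Suc j))"
       "g (t * real (Suc (Suc j))) - g (t * real (Suc j)) = (t * real (Suc (Suc j)) - t * real (Suc j)) * g' z"
      using MVT2[of "t * real (Suc j)" "t * real (Suc (Suc j))" g g'] g' t by auto
    have "0 \<le> t * real (Suc j)" using t by simp
    hence "g' z \<le> g' (t * real (Suc j))" using z by (intro g'_anti) linarith+
    hence "t * g' z \<le> t * g' (t * real (Suc j))" using t by (intro mult_left_mono) auto
    thus "g (t * real (Suc (Suc j))) - g (t * real (Suc j)) \<le> t * g' (t * real (Suc j))"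
      using z(3) by (simp add: algebra_simps)
  qed
  have sum_eq: "t * (\<Sum>j=1..N. occ t j * (1 - occ t j)) = (\<Sum>j<N. t * g' (t * real (Suc j)))" for t N
    unfolding occ_mult_one_minus g'_def sum_distrib_left
    by (rule sum.reindex_bij_witness[of _ Suc "\<lambda>j. j - 1"]) auto
  have up: "t * (\<Sum>j=1..N. occ t j * (1 - occ t j)) \<le> g (t * real N) - g 0" if "0 < t" for t N
  proof -
    have "(\<Sum>j<N. t * g' (t * real (Suc j))) \<le> (\<Sum>j<N. g (t * real (Suc j)) - g (t * real j))"
      using upper[OF that] by (intro sum_mono)
    also have "\<dots> = g (t * real N) - g (t * real 0)"
      using sum_lessThan_telescope[of "\<lambda>j. g (t * real j)" N] by simp
    finally show ?thesis unfolding sum_eq by simp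
  qed
  have low: "g (t * real N) - g t \<le> t * (\<Sum>j=1..N. occ t j * (1 - occ t j))" if "0 < t" for t N
  proof -
    have "g (t * real N) \<le> g (t * real (Suc N))"
      unfolding g_def using that by (intro divide_left_mono add_left_mono) (auto simp: add_pos_pos)
    hence "g (t * real N) - g t \<le> (\<Sum>j<N. g (t * real (Suc (Suc j))) - g (t * real (Suc j)))"
      using sum_lessThan_telescope[of "\<lambda>j. g (t * real (Suc j))" N] by simp
    also have "\<dots> \<le> (\<Sum>j<N. t * g' (t * real (Suc j)))"
      using lower[OF that] by (intro sum_mono)
    finally show ?thesis unfolding sum_eq .
  qed
  show ?thesis
  proof (rule tendsto_sandwich)
    show "(\<lambda>N. g (temp N * real N) - g (temp N)) \<longlonglongrightarrow> 1 / 2"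
      and "(\<lambda>N. g (temp N * real N) - g 0) \<longlonglongrightarrow> 1 / 2"
      unfolding g_def temp_def by real_asymp+
    show "\<forall>\<^sub>F N in sequentially. g (temp N * real N) - g (temp N)
        \<le> temp N * (\<Sum>j=1..N. occ (temp N) j * (1 - occ (temp N) j))"
      by (rule eventually_sequentiallyI[of 1], rule low, rule temp_pos, simp)
    show "\<forall>\<^sub>F N in sequentially. temp N * (\<Sum>j=1..N. occ (temp N) j * (1 - occ (temp N) j))
        \<le> g (temp N * real N) - g 0"
      by (rule eventually_sequentiallyI[of 1], rule up, rule temp_pos, simp)
  qed
qed

text \<open>The variance of the total size, both \<open>L\<close> and \<open>R\<close> contributing equally.\<close>
definition sum_var :: "nat \<Rightarrow> real" where
  "sum_var N = 2 * (\<Sum>j=1..N. (real j)\<^sup>2 * (occ (temp N) j * (1 - occ (temp N) j)))"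

lemma sum_var_le:
  assumes "0 < N"
  shows "sum_var N \<le> 32 / temp N ^ 3"
proof -
  have "(\<Sum>j=1..N. (real j)\<^sup>2 * (occ (temp N) j * (1 - occ (temp N) j)))
     \<le> (\<Sum>j=1..N. real j ^ 2 * exp (- (temp N * real j)))"
    by (intro sum_mono mult_left_mono occ_var_bounds) auto
  also have "\<dots> \<le> 16 / temp N ^ 3"
    using sum_power_mult_exp_le[OF temp_pos[OF assms], of 2 N] by simp
  finally show ?thesis by (simp add: sum_var_def)
qed

lemma sum_squares_ge: "real m ^ 3 / 3 \<le> (\<Sum>j=1..m. (real j)\<^sup>2)"
proof (induction m)
  case (Suc m)
  have "real (Suc m) ^ 3 / 3 \<le> real m ^ 3 / 3 + (real (Suc m))\<^sup>2"
    by (simp add: power2_eq_square power3_eq_cube field_simps)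
  with Suc show ?case by simp
qed simp

text \<open>Keep only \<open>j\<close> up to \<open>1 / t\<close>: there \<open>exp (- t j)\<close>
  is at least \<open>1 / 3\<close> and each variance at least \<open>1 / 12\<close>. As there are at
  least \<open>1 / (2 t)\<close> such \<open>j\<close>, this gives \<open>1 / (144 t^3)\<close>,
  rounded down to \<open>1 / (200 t^3)\<close>.\<close>

lemma eventually_sum_var_ge: "\<forall>\<^sub>F N in sequentially. 1 / (200 * temp N ^ 3) \<le> sum_var N"
proof -
  have "\<forall>\<^sub>F N in sequentially. 0 < N \<and> temp N < 1 / 2 \<and> 1 / temp N < real N"
  proof (intro eventually_conj)
    show "\<forall>\<^sub>F N in sequentially. temp N < 1 / 2" unfolding temp_def by real_asymp
    show "\<forall>\<^sub>F N in sequentially. 1 / temp N < real N" unfolding temp_def by real_asymp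
  qed (rule eventually_gt_at_top)
  thus ?thesis
  proof (rule eventually_mono, elim conjE)
    fix N assume N: "0 < N" "temp N < 1 / 2" "1 / temp N < real N"
    define t where "t = temp N"
    have t: "0 < t" "t < 1 / 2" "1 / t < real N" using N temp_pos[of N] by (auto simp: t_def)
    define m where "m = nat \<lfloor>1 / t\<rfloor>"
    have m: "real m \<le> 1 / t" "1 / t - 1 \<le> real m" using t by (auto simp: m_def)
    have mN: "m \<le> N" using m t by simp
    have "2 < 1 / t" using t by (simp add: field_simps)
    hence m2: "1 / (2 * t) \<le> real m" using m(2) by (simp add: field_simps)
    have "1 / (200 * t ^ 3) \<le> 2 * (1 / 12) * ((1 / (2 * t)) ^ 3 / 3)"
      using t by (simp add: power_mult_distrib power_divide field_simps)
    also have "\<dots> \<le> 2 * (1 / 12) * (real m ^ 3 / 3)"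
      using m2 t by (intro mult_left_mono divide_right_mono power_mono) auto
    also have "\<dots> \<le> 2 * (1 / 12) * (\<Sum>j=1..m. (real j)\<^sup>2)"
      using sum_squares_ge[of m] by (intro mult_left_mono) auto
    also have "\<dots> = 2 * (\<Sum>j=1..m. (real j)\<^sup>2 * (1 / 12))"
      by (simp add: sum_distrib_left sum_divide_distrib)
    also have "\<dots> \<le> 2 * (\<Sum>j=1..m. (real j)\<^sup>2 * (occ t j * (1 - occ t j)))"
    proof (intro mult_left_mono sum_mono)
      fix j assume "j \<in> {1..m}"
      hence "t * real j \<le> t * (1 / t)" using m t by (intro mult_left_mono) auto
      hence "exp (- 1) \<le> exp (- (t * real j))" using t by simp
      moreover have "1 / 3 \<le> exp (- 1 :: real)"
        using e_less_272 by (simp add: exp_minus field_simps)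
      ultimately show "1 / 12 \<le> occ t j * (1 - occ t j)" using occ_var_bounds(3)[of t j] t by linarith
    qed auto
    also have "\<dots> \<le> 2 * (\<Sum>j=1..N. (real j)\<^sup>2 * (occ t j * (1 - occ t j)))"
      using mN occ_var_bounds(1) by (intro mult_left_mono sum_mono2) auto
    finally show "1 / (200 * temp N ^ 3) \<le> sum_var N" by (simp add: sum_var_def t_def)
  qed
qed

section \<open>Gaussian limit and domination of the integrand\<close>

text \<open>The factor with \<open>+ \<alpha>\<close> belongs to the event that \<open>j\<close>
  lies in \<open>R\<close>, the one with \<open>- \<alpha>\<close> to \<open>j\<close> in
  \<open>L\<close>. The variable \<open>\<theta>\<close> is dual to the total size and
  \<open>\<alpha>\<close> to the rank.\<close>

definition pair_char :: "nat \<Rightarrow> nat \<Rightarrow> real \<Rightarrow> real \<Rightarrow> complex" where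
  "pair_char N c \<theta> \<alpha> = (\<Prod>j\<in>{c<..N}. bern_char (occ (temp N) j) (real j * \<theta> + \<alpha>)
                                    * bern_char (occ (temp N) j) (real j * \<theta> - \<alpha>))"

lemma prod_cis: "(\<Prod>j\<in>A. cis (f j)) = cis (\<Sum>j\<in>A. f j)"
  by (induction A rule: infinite_finite_induct) (simp_all add: cis_mult)

lemma norm_mult_diff_le:
  fixes a b c d :: complex
  assumes "norm b \<le> 1" "norm c \<le> 1"
  shows "norm (a * b - c * d) \<le> norm (a - c) + norm (b - d)"
proof -
  have "a * b - c * d = (a - c) * b + c * (b - d)" by (simp add: algebra_simps)
  also have "norm \<dots> \<le> norm (a - c) * norm b + norm c * norm (b - d)"
    by (metis norm_mult norm_triangle_ineq)
  also have "\<dots> \<le> norm (a - c) * 1 + 1 * norm (b - d)"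
    using assms by (intro add_mono mult_mono) auto
  finally show ?thesis by simp
qed

lemma power3_add_le:
  fixes a b :: real
  assumes "0 \<le> a" "0 \<le> b"
  shows "(a + b) ^ 3 \<le> 4 * (a ^ 3 + b ^ 3)"
proof -
  have "0 \<le> 3 * (a + b) * (a - b)\<^sup>2" using assms by simp
  also have "\<dots> = 4 * (a ^ 3 + b ^ 3) - (a + b) ^ 3" by algebra
  finally show ?thesis by simp
qed

lemma power4_add_le:
  fixes a b :: real
  shows "(a + b) ^ 4 \<le> 8 * (a ^ 4 + b ^ 4)"
proof -
  have "(a + b)\<^sup>2 \<le> 2 * (a\<^sup>2 + b\<^sup>2)"
    using zero_le_power2[of "a - b"] by (simp add: power2_eq_square algebra_simps)
  hence "((a + b)\<^sup>2)\<^sup>2 \<le> (2 * (a\<^sup>2 + b\<^sup>2))\<^sup>2" by (intro power_mono) auto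
  also have "\<dots> \<le> 8 * ((a\<^sup>2)\<^sup>2 + (b\<^sup>2)\<^sup>2)"
    using zero_le_power2[of "a\<^sup>2 - b\<^sup>2"] by (simp add: power2_eq_square algebra_simps)
  finally show ?thesis by simp
qed

text \<open>Each factor, centred at its mean, is replaced by its Gaussian counterpart. All factors
  lie in the closed unit disc, so the products differ by at most the sum of the differences. The
  constants 96, 768 and 2 are \<open>fact k * 2 ^ (k + 1)\<close> for
  \<open>k = 3, 4, 0\<close>.\<close>

lemma pair_char_gaussian_approx:
  fixes N :: nat and \<theta> \<alpha> :: real
  defines "t \<equiv> temp N"
  assumes N: "0 < N"
  shows "norm (cis (- (real N * \<theta>)) * pair_char N 0 \<theta> \<alpha>
     - cis (\<theta> * (2 * (\<Sum>j=1..N. real j * occ t j) - real N))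
        * exp (- (\<theta>\<^sup>2 * sum_var N / 2 + \<alpha>\<^sup>2 * (\<Sum>j=1..N. occ t j * (1 - occ t j)))))
     \<le> 3 * (\<bar>\<theta>\<bar> ^ 3 * (96 / t ^ 4) + \<bar>\<alpha>\<bar> ^ 3 * (2 / t)) + 4 * (\<theta> ^ 4 * (768 / t ^ 5) + \<alpha> ^ 4 * (2 / t))"
proof -
  have t: "0 < t" using temp_pos[OF N] by (simp add: t_def)
  define p where "p = occ t"
  have p: "0 \<le> p j" "p j \<le> 1" "p j \<le> exp (- (t * real j))" for j
    unfolding p_def by (rule occ_bounds)+
  define A where "A = (\<lambda>j y. cis (- (p j * y)) * bern_char (p j) y)"
  define B where "B = (\<lambda>j y. complex_of_real (exp (- (p j * (1 - p j) * y\<^sup>2 / 2))))"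
  define yp where "yp = (\<lambda>j. real j * \<theta> + \<alpha>)"
  define ym where "ym = (\<lambda>j. real j * \<theta> - \<alpha>)"
  have nA: "norm (A j y) \<le> 1" for j y
    using norm_bern_char_le_1[OF p(1,2)] by (simp add: A_def norm_mult)
  have nB: "norm (B j y) \<le> 1" for j y
    using p[of j] by (simp add: B_def)
  have I: "{0<..N} = {1..N}" by auto
  have prodA: "(\<Prod>j=1..N. A j (yp j) * A j (ym j)) = cis (- (\<theta> * 2 * (\<Sum>j=1..N. real j * p j))) * pair_char N 0 \<theta> \<alpha>"
  proof -
    have "(\<Prod>j=1..N. A j (yp j) * A j (ym j)) = (\<Prod>j=1..N. cis (- (\<theta> * 2 * (real j * p j))) *
        (bern_char (p j) (yp j) * bern_char (p j) (ym j)))"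
    proof (intro prod.cong refl)
      fix j
      have "A j (yp j) * A j (ym j) = (cis (- (p j * yp j)) * cis (- (p j * ym j))) * (bern_char (p j) (yp j) * bern_char (p j) (ym j))"
        by (simp add: A_def mult_ac)
      also have "cis (- (p j * yp j)) * cis (- (p j * ym j)) = cis (- (\<theta> * 2 * (real j * p j)))"
        by (simp add: cis_mult yp_def ym_def algebra_simps)
      finally show "A j (yp j) * A j (ym j) = cis (- (\<theta> * 2 * (real j * p j))) * (bern_char (p j) (yp j) * bern_char (p j) (ym j))" .
    qed
    also have "\<dots> = (\<Prod>j=1..N. cis (- (\<theta> * 2 * (real j * p j)))) * pair_char N 0 \<theta> \<alpha>"
      unfolding prod.distrib pair_char_def I p_def t_def yp_def ym_def ..
    also have "(\<Prod>j=1..N. cis (- (\<theta> * 2 * (real j * p j)))) = cis (- (\<theta> * 2 * (\<Sum>j=1..N. real j * p j)))"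
      by (simp add: prod_cis sum_distrib_left sum_negf)
    finally show ?thesis .
  qed
  have prodB: "(\<Prod>j=1..N. B j (yp j) * B j (ym j)) = exp (- (\<theta>\<^sup>2 * sum_var N / 2 + \<alpha>\<^sup>2 * (\<Sum>j=1..N. p j * (1 - p j))))"
  proof -
    \<comment> \<open>The squares of \<open>j \<theta> + \<alpha>\<close> and
      \<open>j \<theta> - \<alpha>\<close> add up without a mixed term, so size and rank
      decouple.\<close>
    have "(\<Prod>j=1..N. B j (yp j) * B j (ym j)) = (\<Prod>j=1..N. complex_of_real (exp (- (\<theta>\<^sup>2 * ((real j)\<^sup>2 * (p j * (1 - p j))) + \<alpha>\<^sup>2 * (p j * (1 - p j))))))"
      unfolding B_def of_real_mult[symmetric] exp_add[symmetric]
      by (intro prod.cong refl arg_cong[where f = complex_of_real] arg_cong[where f = exp])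
         (simp add: yp_def ym_def power2_eq_square field_simps)
    also have "\<dots> = exp (\<Sum>j=1..N. - (\<theta>\<^sup>2 * ((real j)\<^sup>2 * (p j * (1 - p j))) + \<alpha>\<^sup>2 * (p j * (1 - p j))))"
      unfolding of_real_prod[symmetric] by (simp only: exp_sum finite_atLeastAtMost)
    also have "(\<Sum>j=1..N. - (\<theta>\<^sup>2 * ((real j)\<^sup>2 * (p j * (1 - p j))) + \<alpha>\<^sup>2 * (p j * (1 - p j)))) =
       - (\<theta>\<^sup>2 * sum_var N / 2 + \<alpha>\<^sup>2 * (\<Sum>j=1..N. p j * (1 - p j)))"
      unfolding sum_negf sum.distrib sum_distrib_left[symmetric] sum_var_def p_def t_def by simp
    finally show ?thesis .
  qed
  have err: "norm (A j (yp j) * A j (ym j) - B j (yp j) * B j (ym j))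
     \<le> 3 * (\<bar>\<theta>\<bar> ^ 3 * (real j ^ 3 * exp (- (t * real j))) + \<bar>\<alpha>\<bar> ^ 3 * (real j ^ 0 * exp (- (t * real j))))
       + 4 * (\<theta> ^ 4 * (real j ^ 4 * exp (- (t * real j))) + \<alpha> ^ 4 * (real j ^ 0 * exp (- (t * real j))))" for j
  proof -
    define a where "a = real j * \<bar>\<theta>\<bar>"
    define b where "b = \<bar>\<alpha>\<bar>"
    have ab: "0 \<le> a" "0 \<le> b" by (auto simp: a_def b_def)
    have one: "norm (A j y - B j y) \<le> exp (- (t * real j)) * (4 * (a ^ 3 + b ^ 3) / 3 + 8 * (a ^ 4 + b ^ 4) / 4)"
      if y: "\<bar>y\<bar> \<le> a + b" for y
    proof -
      have y3: "\<bar>y\<bar> ^ 3 \<le> 4 * (a ^ 3 + b ^ 3)"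
        using power_mono[OF y, of 3] power3_add_le[OF ab] by simp
      have y4: "y ^ 4 \<le> 8 * (a ^ 4 + b ^ 4)"
        using power_mono[OF y, of 4] power4_add_le[of a b] by simp
      have "norm (A j y - B j y) \<le> p j * \<bar>y\<bar> ^ 3 / 3 + p j * y ^ 4 / 4"
        unfolding A_def B_def by (rule bern_char_centered_approx[OF p(1,2)])
      also have "\<dots> = p j * (\<bar>y\<bar> ^ 3 / 3 + y ^ 4 / 4)" by (simp add: algebra_simps)
      also have "\<dots> \<le> exp (- (t * real j)) * (4 * (a ^ 3 + b ^ 3) / 3 + 8 * (a ^ 4 + b ^ 4) / 4)"
        using y3 y4 p[of j] by (intro mult_mono add_mono divide_right_mono) auto
      finally show ?thesis .
    qed
    have "norm (A j (yp j) * A j (ym j) - B j (yp j) * B j (ym j))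
       \<le> norm (A j (yp j) - B j (yp j)) + norm (A j (ym j) - B j (ym j))"
      by (rule norm_mult_diff_le[OF nA nB])
    also have "\<dots> \<le> 2 * (exp (- (t * real j)) * (4 * (a ^ 3 + b ^ 3) / 3 + 8 * (a ^ 4 + b ^ 4) / 4))"
    proof -
      have "\<bar>real j * \<theta>\<bar> = a" by (simp add: a_def abs_mult)
      hence "\<bar>yp j\<bar> \<le> a + b" "\<bar>ym j\<bar> \<le> a + b" unfolding yp_def ym_def b_def by linarith+
      from one[OF this(1)] one[OF this(2)] show ?thesis by linarith
    qed
    also have "\<dots> \<le> 3 * (a ^ 3 * exp (- (t * real j)) + b ^ 3 * exp (- (t * real j))) + 4 * (a ^ 4 * exp (- (t * real j)) + b ^ 4 * exp (- (t * real j)))"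
    proof -
      have "2 * (4 * (a ^ 3 + b ^ 3) / 3 + 8 * (a ^ 4 + b ^ 4) / 4) \<le> 3 * (a ^ 3 + b ^ 3) + 4 * (a ^ 4 + b ^ 4)"
      proof -
        have "0 \<le> a ^ 3" "0 \<le> b ^ 3" using ab by auto
        thus ?thesis by (simp add: field_simps)
      qed
      from mult_left_mono[OF this, of "exp (- (t * real j))"] show ?thesis by (simp add: algebra_simps)
    qed
    finally show ?thesis by (simp add: a_def b_def power_mult_distrib mult_ac)
  qed
  have "norm ((\<Prod>j=1..N. A j (yp j) * A j (ym j)) - (\<Prod>j=1..N. B j (yp j) * B j (ym j)))
     \<le> (\<Sum>j=1..N. norm (A j (yp j) * A j (ym j) - B j (yp j) * B j (ym j)))"
    using nA nB by (intro norm_prod_diff) (auto simp: norm_mult intro!: mult_le_one)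
  also have "\<dots> \<le> (\<Sum>j=1..N. 3 * (\<bar>\<theta>\<bar> ^ 3 * (real j ^ 3 * exp (- (t * real j))) + \<bar>\<alpha>\<bar> ^ 3 * (real j ^ 0 * exp (- (t * real j))))
       + 4 * (\<theta> ^ 4 * (real j ^ 4 * exp (- (t * real j))) + \<alpha> ^ 4 * (real j ^ 0 * exp (- (t * real j)))))"
    by (intro sum_mono err)
  also have "\<dots> = 3 * (\<bar>\<theta>\<bar> ^ 3 * (\<Sum>j=1..N. real j ^ 3 * exp (- (t * real j))) + \<bar>\<alpha>\<bar> ^ 3 * (\<Sum>j=1..N. real j ^ 0 * exp (- (t * real j))))
       + 4 * (\<theta> ^ 4 * (\<Sum>j=1..N. real j ^ 4 * exp (- (t * real j))) + \<alpha> ^ 4 * (\<Sum>j=1..N. real j ^ 0 * exp (- (t * real j))))"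
    by (simp only: sum.distrib flip: sum_distrib_left)
  also have "\<dots> \<le> 3 * (\<bar>\<theta>\<bar> ^ 3 * (96 / t ^ 4) + \<bar>\<alpha>\<bar> ^ 3 * (2 / t)) + 4 * (\<theta> ^ 4 * (768 / t ^ 5) + \<alpha> ^ 4 * (2 / t))"
    using sum_power_mult_exp_le[OF t, of 3 N] sum_power_mult_exp_le[OF t, of 0 N] sum_power_mult_exp_le[OF t, of 4 N]
    by (intro add_mono mult_left_mono) (auto simp: fact_numeral)
  finally have main: "norm ((\<Prod>j=1..N. A j (yp j) * A j (ym j)) - (\<Prod>j=1..N. B j (yp j) * B j (ym j))) \<le> \<dots>" .
  \<comment> \<open>\<open>w\<close> is the phase left over from centring at the mean instead of at
    \<open>N\<close>. Its modulus is 1, so it does not affect the error.\<close>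
  define w where "w = cis (\<theta> * (2 * (\<Sum>j=1..N. real j * p j) - real N))"
  have "cis (- (real N * \<theta>)) * pair_char N 0 \<theta> \<alpha> = w * (\<Prod>j=1..N. A j (yp j) * A j (ym j))"
    unfolding prodA mult.assoc[symmetric] w_def cis_mult by (simp add: algebra_simps)
  hence "cis (- (real N * \<theta>)) * pair_char N 0 \<theta> \<alpha> - w * (\<Prod>j=1..N. B j (yp j) * B j (ym j)) =
     w * ((\<Prod>j=1..N. A j (yp j) * A j (ym j)) - (\<Prod>j=1..N. B j (yp j) * B j (ym j)))"
    by (simp add: algebra_simps)
  moreover have "norm w = 1" by (simp add: w_def)
  ultimately have "norm (cis (- (real N * \<theta>)) * pair_char N 0 \<theta> \<alpha> - w * (\<Prod>j=1..N. B j (yp j) * B j (ym j)))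
      = norm ((\<Prod>j=1..N. A j (yp j) * A j (ym j)) - (\<Prod>j=1..N. B j (yp j) * B j (ym j)))"
    by (simp only: norm_mult mult_1)
  with main show ?thesis unfolding prodB w_def p_def by simp
qed

text \<open>Follows from the lower bound \<open>1 / (200 t^3)\<close> for the variance and
  \<open>200 \<le> 15^2\<close>. It ties the frequency at fixed \<open>u\<close> to the scale
  \<open>t powr (3/2)\<close>.\<close>

lemma eventually_theta_le:
  "\<forall>\<^sub>F N in sequentially. 0 < N \<and> 0 < temp N \<and> 0 < sum_var N \<and> (\<forall>u. \<bar>u / sqrt (sum_var N)\<bar> \<le> 15 * \<bar>u\<bar> * temp N powr (3/2))"
  using eventually_sum_var_ge eventually_gt_at_top[of 0]
proof eventually_elim
  case (elim N)
  define t where "t = temp N"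
  have t: "0 < t" using temp_pos elim by (simp add: t_def)
  have "0 < 1 / (200 * t ^ 3)" using t by simp
  also have "\<dots> \<le> sum_var N" using elim by (simp add: t_def)
  finally have V: "0 < sum_var N" .
  have "1 \<le> 200 * t ^ 3 * sum_var N"
    using elim t by (simp add: t_def field_simps)
  also have "\<dots> \<le> (15 * t powr (3/2))\<^sup>2 * sum_var N"
  proof -
    have "(t powr (3/2))\<^sup>2 = t ^ 3"
      using t by (simp add: powr_power powr_numeral)
    thus ?thesis using t V by (simp add: power_mult_distrib)
  qed
  finally have "sqrt 1 \<le> sqrt ((15 * t powr (3/2))\<^sup>2 * sum_var N)" by (rule real_sqrt_le_mono)
  hence "1 / sqrt (sum_var N) \<le> 15 * t powr (3/2)"
    using V by (simp add: real_sqrt_mult field_simps)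
  hence "\<bar>u\<bar> * (1 / sqrt (sum_var N)) \<le> \<bar>u\<bar> * (15 * t powr (3/2))" for u
    by (intro mult_left_mono) auto
  thus ?case using elim V t by (simp add: t_def mult_ac)
qed

lemma pair_char_tendsto:
  "(\<lambda>N. cis (- (real N * (u / sqrt (sum_var N)))) * pair_char N 0 (u / sqrt (sum_var N)) (x * sqrt (temp N)))
     \<longlonglongrightarrow> of_real (exp (- (u\<^sup>2 + x\<^sup>2) / 2))"
proof -
  define th where "th = (\<lambda>N. u / sqrt (sum_var N))"
  define al where "al = (\<lambda>N. x * sqrt (temp N))"
  define m where "m = (\<lambda>N. 2 * (\<Sum>j=1..N. real j * occ (temp N) j) - real N)"
  define q where "q = (\<lambda>N. \<Sum>j=1..N. occ (temp N) j * (1 - occ (temp N) j))"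
  define main where "main = (\<lambda>N. cis (th N * m N) * complex_of_real (exp (- ((th N)\<^sup>2 * sum_var N / 2 + (al N)\<^sup>2 * q N))))"
  define E where "E = (\<lambda>t::real. 3 * ((15 * \<bar>u\<bar> * t powr (3/2)) ^ 3 * (96 / t ^ 4) + (\<bar>x\<bar> * t powr (1/2)) ^ 3 * (2 / t))
     + 4 * ((15 * \<bar>u\<bar> * t powr (3/2)) ^ 4 * (768 / t ^ 5) + (\<bar>x\<bar> * t powr (1/2)) ^ 4 * (2 / t)))"
  \<comment> \<open>The four error terms have the orders \<open>t powr (1/2)\<close>,
    \<open>t powr (1/2)\<close>, \<open>t\<close> and \<open>t\<close>.\<close>
  have l: "((\<lambda>t::real. (t powr (3/2)) ^ 3 * (96 / t ^ 4)) \<longlongrightarrow> 0) (at_right 0)"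
    "((\<lambda>t::real. (t powr (1/2)) ^ 3 * (2 / t)) \<longlongrightarrow> 0) (at_right 0)"
    "((\<lambda>t::real. (t powr (3/2)) ^ 4 * (768 / t ^ 5)) \<longlongrightarrow> 0) (at_right 0)"
    "((\<lambda>t::real. (t powr (1/2)) ^ 4 * (2 / t)) \<longlongrightarrow> 0) (at_right 0)"
    by real_asymp+
  have "((\<lambda>t. 3 * ((15 * \<bar>u\<bar>) ^ 3 * ((t powr (3/2)) ^ 3 * (96 / t ^ 4)) + \<bar>x\<bar> ^ 3 * ((t powr (1/2)) ^ 3 * (2 / t)))
       + 4 * ((15 * \<bar>u\<bar>) ^ 4 * ((t powr (3/2)) ^ 4 * (768 / t ^ 5)) + \<bar>x\<bar> ^ 4 * ((t powr (1/2)) ^ 4 * (2 / t))))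
      \<longlongrightarrow> 3 * ((15 * \<bar>u\<bar>) ^ 3 * 0 + \<bar>x\<bar> ^ 3 * 0) + 4 * ((15 * \<bar>u\<bar>) ^ 4 * 0 + \<bar>x\<bar> ^ 4 * 0)) (at_right 0)"
    by (intro tendsto_add tendsto_mult tendsto_const l)
  hence "(E \<longlongrightarrow> 0) (at_right 0)"
    by (simp only: E_def power_mult_distrib mult.assoc mult_zero_right add_0)
  hence Elim: "(\<lambda>N. E (temp N)) \<longlonglongrightarrow> 0"
    using temp_at_right_0 by (rule filterlim_compose)
  have mainlim: "main \<longlonglongrightarrow> of_real (exp (- (u\<^sup>2 + x\<^sup>2) / 2))"
  proof -
    \<comment> \<open>The phase vanishes because the mean differs from \<open>N\<close> by less than
      the order of the standard deviation.\<close>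
    have "(\<lambda>N. th N * m N) \<longlonglongrightarrow> 0"
    proof (rule Lim_null_comparison)
      show "\<forall>\<^sub>F N in sequentially. norm (th N * m N) \<le> 15 * \<bar>u\<bar> * \<bar>temp N powr (3/2) * m N\<bar>"
        using eventually_theta_le
      proof eventually_elim
        case (elim N)
        hence "\<bar>th N\<bar> * \<bar>m N\<bar> \<le> 15 * \<bar>u\<bar> * temp N powr (3/2) * \<bar>m N\<bar>"
          unfolding th_def by (intro mult_right_mono) auto
        thus ?case by (simp add: abs_mult mult_ac)
      qed
      show "(\<lambda>N. 15 * \<bar>u\<bar> * \<bar>temp N powr (3/2) * m N\<bar>) \<longlonglongrightarrow> 0"
        using tendsto_mult_right_zero[OF tendsto_rabs_zero[OF occ_mean_asymp]] by (simp add: m_def)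
    qed
    hence 1: "(\<lambda>N. cis (th N * m N)) \<longlonglongrightarrow> cis 0" by (rule tendsto_cis)
    have "(\<lambda>N. exp (- (u\<^sup>2 / 2 + x\<^sup>2 * (temp N * q N)))) \<longlonglongrightarrow> exp (- (u\<^sup>2 / 2 + x\<^sup>2 * (1 / 2)))"
      using sum_occ_var_asymp by (intro tendsto_intros) (simp add: q_def)
    moreover have "\<forall>\<^sub>F N in sequentially. exp (- (u\<^sup>2 / 2 + x\<^sup>2 * (temp N * q N))) = exp (- ((th N)\<^sup>2 * sum_var N / 2 + (al N)\<^sup>2 * q N))"
      using eventually_theta_le
      by eventually_elim (simp add: th_def al_def power_divide power_mult_distrib)
    ultimately have "(\<lambda>N. exp (- ((th N)\<^sup>2 * sum_var N / 2 + (al N)\<^sup>2 * q N))) \<longlonglongrightarrow> exp (- (u\<^sup>2 / 2 + x\<^sup>2 * (1 / 2)))"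
      by (rule Lim_transform_eventually)
    from tendsto_mult[OF 1 tendsto_of_real[OF this]] show ?thesis by (simp add: main_def diff_divide_distrib)
  qed
  have "(\<lambda>N. cis (- (real N * th N)) * pair_char N 0 (th N) (al N) - main N) \<longlonglongrightarrow> 0"
  proof (rule Lim_null_comparison[OF _ Elim])
    show "\<forall>\<^sub>F N in sequentially. norm (cis (- (real N * th N)) * pair_char N 0 (th N) (al N) - main N) \<le> E (temp N)"
      using eventually_theta_le
    proof eventually_elim
      case (elim N)
      define t where "t = temp N"
      have t: "0 < t" using elim by (simp add: t_def)
      have th: "\<bar>th N\<bar> \<le> 15 * \<bar>u\<bar> * t powr (3/2)" using elim unfolding th_def t_def by blast
      have al: "\<bar>al N\<bar> = \<bar>x\<bar> * t powr (1/2)" using t by (simp add: al_def t_def abs_mult powr_half_sqrt)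
      have th4: "th N ^ 4 \<le> (15 * \<bar>u\<bar> * t powr (3/2)) ^ 4"
        using power_mono[OF th, of 4] by simp
      have al4: "al N ^ 4 = (\<bar>x\<bar> * t powr (1/2)) ^ 4" unfolding al[symmetric] by simp
      have "norm (cis (- (real N * th N)) * pair_char N 0 (th N) (al N) - main N)
        \<le> 3 * (\<bar>th N\<bar> ^ 3 * (96 / t ^ 4) + \<bar>al N\<bar> ^ 3 * (2 / t)) + 4 * (th N ^ 4 * (768 / t ^ 5) + al N ^ 4 * (2 / t))"
        unfolding main_def m_def q_def t_def using elim by (intro pair_char_gaussian_approx) auto
      also have "\<dots> \<le> E t"
        unfolding E_def al al4 using power_mono[OF th, of 3] th4 t
        by (intro add_mono mult_left_mono mult_right_mono order.refl) auto
      finally show ?case by (simp add: t_def)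
    qed
  qed
  from tendsto_add[OF this mainlim] show ?thesis by (simp add: th_def al_def)
qed

section \<open>Uniform decay of the integrand\<close>

lemma one_minus_cos_ge:
  assumes "\<bar>y\<bar> \<le> pi"
  shows "2 * y\<^sup>2 / pi\<^sup>2 \<le> 1 - cos y"
proof -
  define s where "s = \<bar>y\<bar> / pi"
  have s: "0 \<le> s" "s \<le> 1" using assms by (auto simp: s_def)
  \<comment> \<open>Jordan's inequality: on \<open>[0, pi / 2]\<close> the sine lies above its
    chord. It is used through \<open>1 - cos y = 2 * (sin (y / 2))^2\<close>.\<close>
  have "concave_on {0..pi / 2} sin"
    by (rule f''_le0_imp_concave[where f' = cos and f'' = "\<lambda>x. - sin x"])
       (auto intro!: derivative_eq_intros sin_ge_zero)
  from concave_onD[OF this s, of 0 "pi / 2"] have "s \<le> sin (s * (pi / 2))" by simp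
  hence "s\<^sup>2 \<le> (sin (s * (pi / 2)))\<^sup>2" using s by (intro power_mono) auto
  also have "s * (pi / 2) = \<bar>y\<bar> / 2" by (simp add: s_def)
  finally have "2 * s\<^sup>2 \<le> 2 * (sin (\<bar>y\<bar> / 2))\<^sup>2" by simp
  also have "\<dots> = 1 - cos \<bar>y\<bar>" using cos_double_sin[of "\<bar>y\<bar> / 2"] by simp
  finally show ?thesis by (simp add: s_def power_divide)
qed

text \<open>The real part of the geometric series with ratio \<open>z = r * cis y\<close> is
  subtracted from the series with ratio \<open>r\<close>. With \<open>k = r * (1 - cos y)\<close>,
  the squared modulus of \<open>1 - z\<close> is \<open>(1 - r)^2 + 2 k\<close>.\<close>

lemma geometric_cos_sums:
  assumes "0 \<le> r" "r < 1"
  shows "(\<lambda>j. r ^ j * (1 - cos (real j * y))) sums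
           (r * (1 - cos y) * (1 + r) / ((1 - r) * ((1 - r)\<^sup>2 + 2 * (r * (1 - cos y)))))"
proof -
  define z where "z = of_real r * cis y"
  have nz: "norm z < 1" using assms by (simp add: z_def norm_mult)
  have "(\<lambda>j. Re (z ^ j)) sums Re (1 / (1 - z))"
    by (rule sums_Re[OF geometric_sums[OF nz]])
  moreover have "Re (z ^ j) = r ^ j * cos (real j * y)" for j
    by (simp add: z_def power_mult_distrib Complex.DeMoivre flip: of_real_power)
  moreover have "(\<lambda>j. r ^ j) sums (1 / (1 - r))" using assms by (intro geometric_sums) auto
  ultimately have s: "(\<lambda>j. r ^ j * (1 - cos (real j * y))) sums (1 / (1 - r) - Re (1 / (1 - z)))"
    using sums_diff by (fastforce simp: right_diff_distrib)
  define k where "k = r * (1 - cos y)"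
  define d where "d = 1 - r"
  have d: "0 < d" "0 \<le> k" using assms by (auto simp: d_def k_def)
  have "Re (1 / (1 - z)) = (d + k) / (d\<^sup>2 + 2 * k)"
  proof -
    have "(1 - r * cos y)\<^sup>2 + (r * sin y)\<^sup>2 = 1 - 2 * r * cos y + r\<^sup>2 * ((sin y)\<^sup>2 + (cos y)\<^sup>2)"
      by algebra
    also have "\<dots> = d\<^sup>2 + 2 * k"
      unfolding sin_cos_squared_add by (simp add: d_def k_def power2_eq_square algebra_simps)
    finally have "(1 - r * cos y)\<^sup>2 + (r * sin y)\<^sup>2 = d\<^sup>2 + 2 * k" .
    thus ?thesis by (simp add: Re_divide z_def d_def k_def algebra_simps)
  qed
  moreover have "0 < d\<^sup>2 + 2 * k" using d by (intro add_pos_nonneg) auto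
  moreover from this have "1 / d - (d + k) / (d\<^sup>2 + 2 * k) = k * (2 - d) / (d * (d\<^sup>2 + 2 * k))"
    using d by (simp add: divide_simps) (simp add: power2_eq_square algebra_simps)
  ultimately have "1 / d - Re (1 / (1 - z)) = k * (2 - d) / (d * (d\<^sup>2 + 2 * k))" by (simp only:)
  with s show ?thesis by (simp add: d_def k_def)
qed

lemma exp_minus_le_6_div_cube:
  fixes v :: real
  assumes "0 < v"
  shows "exp (- v) \<le> 6 / v ^ 3"
proof -
  have "v ^ 3 / fact 3 \<le> exp v" using assms by (intro power_div_fact_le_exp) auto
  thus ?thesis using assms by (simp add: exp_minus field_simps fact_numeral)
qed

text \<open>The whole series has a closed form; the terms up to \<open>c\<close> cost at most
  \<open>2 c\<close> and those beyond \<open>N\<close> at most 2. The closed form is then bounded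
  below using \<open>1 - r \<le> t\<close> and \<open>k \<ge> y^2 / pi^2\<close>.\<close>

lemma sum_cos_ge:
  fixes N c :: nat and y :: real
  defines "t \<equiv> temp N"
  assumes N: "0 < N" "c \<le> N" "t \<le> 1 / 2" "\<bar>y\<bar> \<le> pi"
  shows "y\<^sup>2 / (t * (pi\<^sup>2 * t\<^sup>2 + 2 * y\<^sup>2)) - 2 * real c - 2
           \<le> (\<Sum>j\<in>{c<..N}. exp (- (t * real j)) * (1 - cos (real j * y)))"
proof -
  have t: "0 < t" using temp_pos[OF N(1)] by (simp add: t_def)
  define r where "r = exp (- t)"
  have r: "0 < r" "r < 1" "1 - r \<le> t" "1 / 2 \<le> r"
    using t N(3) exp_ge_add_one_self[of "- t"] by (auto simp: r_def simp del: exp_ge_add_one_self)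
  define f where "f = (\<lambda>j. r ^ j * (1 - cos (real j * y)))"
  define k where "k = r * (1 - cos y)"
  define S where "S = k * (1 + r) / ((1 - r) * ((1 - r)\<^sup>2 + 2 * k))"
  have fS: "f sums S"
    unfolding f_def S_def k_def using r by (intro geometric_cos_sums) auto
  have f0: "0 \<le> f j" "f j \<le> 2 * r ^ j" for j
    using r mult_left_mono[of "1 - cos (real j * y)" 2 "r ^ j"] cos_ge_minus_one[of "real j * y"]
    by (auto simp: f_def)
  have rj: "r ^ j = exp (- (t * real j))" for j
    by (simp add: r_def mult.commute flip: exp_of_nat_mult)
  have tail: "(\<Sum>j. f (j + Suc N)) \<le> 2"
  proof -
    have s1: "(\<lambda>j. 2 * r ^ Suc N * r ^ j) sums (2 * r ^ Suc N * (1 / (1 - r)))"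
      using r by (intro sums_mult geometric_sums) auto
    have s2: "(\<lambda>j. f (j + Suc N)) sums (\<Sum>j. f (j + Suc N))"
      using sums_summable[OF fS] by (intro summable_sums summable_ignore_initial_segment)
    have "f (j + Suc N) \<le> 2 * r ^ Suc N * r ^ j" for j
      using f0(2)[of "j + Suc N"] by (simp add: power_add mult_ac)
    from sums_le[OF this s2 s1] have "(\<Sum>j. f (j + Suc N)) \<le> 2 * r ^ Suc N * (1 / (1 - r))" .
    also have "\<dots> = 2 * (r ^ N * (1 / (exp t - 1)))"
      using r t by (simp add: r_def exp_minus field_simps)
    also have "\<dots> \<le> 2 * ((1 / (t * real N)) * (1 / t))"
    proof (intro mult_left_mono mult_mono)
      have "t * real N \<le> exp (t * real N)" using exp_ge_add_one_self[of "t * real N"] by linarith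
      thus "r ^ N \<le> 1 / (t * real N)"
        unfolding rj exp_minus using t N by (simp add: field_simps)
      show "1 / (exp t - 1) \<le> 1 / t"
        using t exp_ge_add_one_self[of t] by (intro divide_left_mono) (auto simp del: exp_ge_add_one_self)
    qed (use t in auto)
    \<comment> \<open>At the saddle point \<open>t^2 * N = pi^2 / 6\<close>, so the tail is bounded
      uniformly in \<open>N\<close>.\<close>
    also have "\<dots> = 2 * (6 / pi\<^sup>2)"
      using temp_sq_mult[OF N(1)] t N(1) by (simp add: field_simps power2_eq_square flip: t_def)
    also have "\<dots> \<le> 2 * 1"
      using power_mono[of 3 pi 2] pi_gt3 by (intro mult_left_mono) auto
    finally show ?thesis by simp
  qed
  have head: "(\<Sum>j\<le>c. f j) \<le> 2 * real c"
  proof -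
    have "(\<Sum>j\<le>c. f j) = (\<Sum>j\<in>{1..c}. f j)"
      by (rule sum.mono_neutral_right) (auto simp: f_def Suc_le_eq)
    also have "\<dots> \<le> (\<Sum>j\<in>{1..c}. 2)"
      using f0(2) r by (intro sum_mono order.trans[OF f0(2)]) (auto intro: power_le_one)
    finally show ?thesis by simp
  qed
  have "S = (\<Sum>j. f (j + Suc N)) + (\<Sum>j<Suc N. f j)"
    using suminf_split_initial_segment[OF sums_summable[OF fS], of "Suc N"] sums_unique[OF fS] by metis
  also have "(\<Sum>j<Suc N. f j) = (\<Sum>j\<le>c. f j) + (\<Sum>j\<in>{c<..N}. f j)"
  proof -
    have un: "{..<Suc N} = {..c} \<union> {c<..N}" using N(2) by auto
    have "{..c} \<inter> {c<..N} = {}" by auto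
    thus ?thesis unfolding un by (intro sum.union_disjoint) simp_all
  qed
  finally have "S - 2 * real c - 2 \<le> (\<Sum>j\<in>{c<..N}. f j)" using head tail by linarith
  moreover have "y\<^sup>2 / (t * (pi\<^sup>2 * t\<^sup>2 + 2 * y\<^sup>2)) \<le> S"
  proof (cases "y = 0")
    case False
    define k0 where "k0 = y\<^sup>2 / pi\<^sup>2"
    have k0: "0 < k0" using False by (simp add: k0_def)
    have k: "k0 \<le> k"
    proof -
      have "1 / 2 * (2 * y\<^sup>2 / pi\<^sup>2) \<le> r * (1 - cos y)"
        using one_minus_cos_ge[OF N(4)] r by (intro mult_mono) auto
      thus ?thesis by (simp add: k0_def k_def)
    qed
    have y2: "y\<^sup>2 = pi\<^sup>2 * k0" by (simp add: k0_def)
    have "t * (pi\<^sup>2 * t\<^sup>2 + 2 * y\<^sup>2) = pi\<^sup>2 * (t * (t\<^sup>2 + 2 * k0))"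
      unfolding y2 by (simp add: algebra_simps)
    hence "y\<^sup>2 / (t * (pi\<^sup>2 * t\<^sup>2 + 2 * y\<^sup>2)) = pi\<^sup>2 * k0 / (pi\<^sup>2 * (t * (t\<^sup>2 + 2 * k0)))"
      by (simp only: y2)
    also have "\<dots> = k0 / (t * (t\<^sup>2 + 2 * k0))" by simp
    \<comment> \<open>Cancelling \<open>k0\<close> makes the monotonicity in both \<open>k0\<close>
      and \<open>t\<close> evident.\<close>
    also have "t * (t\<^sup>2 + 2 * k0) = k0 * (t * (t\<^sup>2 / k0 + 2))"
      using k0 by (simp add: distrib_left)
    also have "k0 / (k0 * (t * (t\<^sup>2 / k0 + 2))) = 1 / (t * (t\<^sup>2 / k0 + 2))"
      using k0 by simp
    also have "\<dots> \<le> 1 / ((1 - r) * ((1 - r)\<^sup>2 / k + 2))"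
    proof (rule divide_left_mono)
      have "(1 - r)\<^sup>2 \<le> t\<^sup>2" using r by (intro power_mono) auto
      hence "(1 - r)\<^sup>2 / k \<le> t\<^sup>2 / k0" using k k0 by (intro frac_le) auto
      thus "(1 - r) * ((1 - r)\<^sup>2 / k + 2) \<le> t * (t\<^sup>2 / k0 + 2)"
        using r t k k0 by (intro mult_mono) auto
      have "0 < (1 - r)\<^sup>2 / k + 2" "0 < t\<^sup>2 / k0 + 2" using k k0 by (auto intro!: add_nonneg_pos)
      thus "0 < t * (t\<^sup>2 / k0 + 2) * ((1 - r) * ((1 - r)\<^sup>2 / k + 2))" using r t by simp
    qed simp
    also have "\<dots> = k / (k * ((1 - r) * ((1 - r)\<^sup>2 / k + 2)))"
      using k k0 by simp
    also have "k * ((1 - r) * ((1 - r)\<^sup>2 / k + 2)) = (1 - r) * ((1 - r)\<^sup>2 + 2 * k)"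
      using k k0 by (simp add: distrib_left mult_ac)
    also have "k / ((1 - r) * ((1 - r)\<^sup>2 + 2 * k)) = k * 1 / ((1 - r) * ((1 - r)\<^sup>2 + 2 * k))" by simp
    also have "\<dots> \<le> S"
      unfolding S_def using r k k0 by (intro divide_right_mono mult_left_mono mult_nonneg_nonneg add_nonneg_nonneg) auto
    finally show ?thesis .
  qed (use r in \<open>auto simp: S_def k_def\<close>)
  ultimately show ?thesis unfolding f_def rj by linarith
qed

text \<open>The bounds for the factors at \<open>j \<theta> + \<alpha>\<close> and
  \<open>j \<theta> - \<alpha>\<close> combine to
  \<open>2 - 2 cos \<alpha> cos (j \<theta>)\<close>, which is at least
  \<open>1 - cos (j \<theta>)\<close> once \<open>cos \<alpha>\<close> is at least
  \<open>1 / 2\<close>. The 4 comes from the lower bound for the variance of a single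
  variable.\<close>

lemma norm_pair_char_le:
  assumes "1 / 2 \<le> cos \<alpha>"
  shows "norm (pair_char N c \<theta> \<alpha>)
    \<le> exp (- ((\<Sum>j\<in>{c<..N}. exp (- (temp N * real j)) * (1 - cos (real j * \<theta>))) / 4))"
proof -
  define t where "t = temp N"
  have t: "0 \<le> t" by (simp add: t_def temp_def)
  define v where "v = (\<lambda>j. occ t j * (1 - occ t j))"
  have "norm (pair_char N c \<theta> \<alpha>) = (\<Prod>j\<in>{c<..N}. norm (bern_char (occ t j) (real j * \<theta> + \<alpha>)) * norm (bern_char (occ t j) (real j * \<theta> - \<alpha>)))"
    by (simp add: pair_char_def prod_norm norm_mult t_def flip: prod_norm)
  also have "\<dots> \<le> (\<Prod>j\<in>{c<..N}. exp (- (exp (- (t * real j)) * (1 - cos (real j * \<theta>)) / 4)))"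
  proof (intro prod_mono conjI)
    fix j
    have "norm (bern_char (occ t j) (real j * \<theta> + \<alpha>)) * norm (bern_char (occ t j) (real j * \<theta> - \<alpha>))
       \<le> exp (- (v j * (1 - cos (real j * \<theta> + \<alpha>)))) * exp (- (v j * (1 - cos (real j * \<theta> - \<alpha>))))"
      unfolding v_def by (intro mult_mono norm_bern_char_le) auto
    also have "\<dots> = exp (- (v j * (2 - 2 * cos \<alpha> * cos (real j * \<theta>))))"
      by (simp add: cos_add cos_diff algebra_simps flip: exp_add)
    also have "\<dots> \<le> exp (- (exp (- (t * real j)) * (1 - cos (real j * \<theta>)) / 4))"
    proof -
      have "(exp (- (t * real j)) / 4) * (1 - cos (real j * \<theta>)) \<le> v j * (2 - 2 * cos \<alpha> * cos (real j * \<theta>))"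
      proof (intro mult_mono)
        show "exp (- (t * real j)) / 4 \<le> v j" unfolding v_def using t by (rule occ_var_bounds)
        have "0 \<le> (2 * cos \<alpha> - 1) * (1 - cos (real j * \<theta>))" using assms by (intro mult_nonneg_nonneg) auto
        also have "\<dots> = 2 * cos \<alpha> - 1 + cos (real j * \<theta>) - 2 * cos \<alpha> * cos (real j * \<theta>)"
          by (simp add: algebra_simps)
        finally show "1 - cos (real j * \<theta>) \<le> 2 - 2 * cos \<alpha> * cos (real j * \<theta>)"
          using cos_le_one[of \<alpha>] by linarith
      qed (auto simp: v_def occ_var_bounds)
      thus ?thesis by simp
    qed
    finally show "norm (bern_char (occ t j) (real j * \<theta> + \<alpha>)) * norm (bern_char (occ t j) (real j * \<theta> - \<alpha>))
       \<le> exp (- (exp (- (t * real j)) * (1 - cos (real j * \<theta>)) / 4))" .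
  qed auto
  also have "\<dots> = exp (- ((\<Sum>j\<in>{c<..N}. exp (- (t * real j)) * (1 - cos (real j * \<theta>))) / 4))"
    by (simp add: exp_sum sum_negf sum_divide_distrib flip: exp_sum)
  finally show ?thesis by (simp add: t_def)
qed

text \<open>The exponential pays for the loss \<open>2 c + 2\<close> in \<open>sum_cos_ge\<close>,
  divided by 4. In the rest, \<open>320 = 10 * 32\<close> stems from \<open>pi^2 \<le> 10\<close>
  and \<open>sum_var N \<le> 32 / temp N ^ 3\<close>; then \<open>1288 = 4 * (320 + 2)\<close>,
  \<open>321 = 320 + 1\<close>, and the 6 is that of
  \<open>exp (- v) \<le> 6 / v ^ 3\<close>.\<close>

definition dom_const :: "nat \<Rightarrow> real" where
  "dom_const c = exp ((real c + 1) / 2) * (6 * 1288 ^ 3 * 321)"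

text \<open>The decay comes from \<open>exp (- (y / 4))\<close> with
  \<open>y = u^2 / (320 + 2 t u^2)\<close>. If \<open>t u^2 \<le> 1\<close>, then \<open>y\<close>
  is at least \<open>u^2 / 322\<close>, which beats \<open>1 + u^2\<close>. Otherwise
  \<open>y\<close> is at least \<open>1 / (322 t)\<close>, so the exponential is of order at most
  \<open>t^3\<close>, while the frequency bound \<open>pi\<close> forces
  \<open>u^2 \<le> 320 / t^3\<close>.\<close>

lemma eventually_pair_char_dominated:
  "\<forall>\<^sub>F N in sequentially. \<forall>u. \<bar>u / sqrt (sum_var N)\<bar> \<le> pi \<longrightarrow>
     norm (pair_char N c (u / sqrt (sum_var N)) (x * sqrt (temp N))) \<le> dom_const c / (1 + u\<^sup>2)"
proof -
  have "((\<lambda>t. cos (x * sqrt t)) \<longlongrightarrow> cos (x * sqrt 0)) (at_right 0)"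
    by (intro tendsto_intros)
  hence "(\<lambda>N. cos (x * sqrt (temp N))) \<longlonglongrightarrow> cos (x * sqrt 0)"
    using temp_at_right_0 by (rule filterlim_compose)
  hence "(\<lambda>N. cos (x * sqrt (temp N))) \<longlonglongrightarrow> 1" by simp
  hence ev1: "\<forall>\<^sub>F N in sequentially. 1 / 2 < cos (x * sqrt (temp N))"
    by (rule order_tendstoD) simp
  have ev2: "\<forall>\<^sub>F N in sequentially. temp N \<le> 1 / 2" unfolding temp_def by real_asymp
  show ?thesis
    using ev1 ev2 eventually_theta_le eventually_ge_at_top[of c]
  proof eventually_elim
    case (elim N)
    define t where "t = temp N"
    define V where "V = sum_var N"
    have t: "0 < t" "t \<le> 1 / 2" and V: "0 < V" and N: "0 < N" "c \<le> N"
      using elim by (auto simp: t_def V_def)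
    have V32: "V * t ^ 3 \<le> 32" using sum_var_le[OF N(1)] t by (simp add: V_def t_def field_simps)
    show ?case
    proof (intro allI impI)
      fix u assume u: "\<bar>u / sqrt (sum_var N)\<bar> \<le> pi"
      define th where "th = u / sqrt V"
      define y where "y = u\<^sup>2 / (320 + 2 * t * u\<^sup>2)"
      have pi10: "pi\<^sup>2 \<le> 10"
        using power_mono[of pi "3.15" 2] pi_approx by (simp add: power2_eq_square)
      have th2: "th\<^sup>2 = u\<^sup>2 / V" using V by (simp add: th_def power_divide)
      have den: "0 < 320 + 2 * t * u\<^sup>2" using t by (intro add_pos_nonneg) auto
      have y: "y \<le> th\<^sup>2 / (t * (pi\<^sup>2 * t\<^sup>2 + 2 * th\<^sup>2))"
      proof (cases "u = 0")
        case False
        have eq: "th\<^sup>2 / (t * (pi\<^sup>2 * t\<^sup>2 + 2 * th\<^sup>2)) = u\<^sup>2 / (pi\<^sup>2 * (V * t ^ 3) + 2 * t * u\<^sup>2)"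
        proof -
          have "t * (pi\<^sup>2 * t\<^sup>2 + 2 * th\<^sup>2) = (pi\<^sup>2 * (V * t ^ 3) + 2 * t * u\<^sup>2) / V"
            unfolding th2 using V by (simp add: field_simps power2_eq_square power3_eq_cube)
          thus ?thesis unfolding th2 using V by simp
        qed
        have "pi\<^sup>2 * (V * t ^ 3) \<le> 10 * 32" using pi10 V32 V t by (intro mult_mono) auto
        thus ?thesis unfolding y_def eq using V t False
          by (intro divide_left_mono add_right_mono mult_pos_pos add_pos_nonneg) auto
      qed (simp add: y_def th_def)
      have "norm (pair_char N c th (x * sqrt t)) \<le> exp (- ((y - 2 * real c - 2) / 4))"
      proof -
        have "y - 2 * real c - 2 \<le> (\<Sum>j\<in>{c<..N}. exp (- (t * real j)) * (1 - cos (real j * th)))"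
          using sum_cos_ge[OF N, of th] y t u by (simp add: th_def V_def t_def)
        moreover have "norm (pair_char N c th (x * sqrt t)) \<le> exp (- ((\<Sum>j\<in>{c<..N}. exp (- (t * real j)) * (1 - cos (real j * th))) / 4))"
          unfolding t_def using elim by (intro norm_pair_char_le) auto
        ultimately show ?thesis by (elim order.trans) simp
      qed
      also have "\<dots> = exp ((real c + 1) / 2) * exp (- (y / 4))"
        by (simp add: field_simps flip: exp_add)
      also have "\<dots> \<le> exp ((real c + 1) / 2) * ((6 * 1288 ^ 3 * 321) / (1 + u\<^sup>2))"
      proof (intro mult_left_mono)
        have u0: "0 < 1 + u\<^sup>2" by (intro add_pos_nonneg) auto
        show "exp (- (y / 4)) \<le> (6 * 1288 ^ 3 * 321) / (1 + u\<^sup>2)"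
        proof (cases "t * u\<^sup>2 \<le> 1")
          case True
          have "u\<^sup>2 / 322 \<le> y" unfolding y_def using True den by (intro divide_left_mono) auto
          hence "1 + u\<^sup>2 / 1288 \<le> 1 + y / 4" by simp
          also have "\<dots> \<le> exp (y / 4)" by (rule exp_ge_add_one_self)
          finally have le: "1 + u\<^sup>2 / 1288 \<le> exp (y / 4)" .
          have "(1 + u\<^sup>2) / (6 * 1288 ^ 3 * 321) \<le> 1 + u\<^sup>2 / 1288" by (simp add: field_simps)
          with le have "(1 + u\<^sup>2) / (6 * 1288 ^ 3 * 321) \<le> exp (y / 4)" by linarith
          thus ?thesis using u0 by (simp add: exp_minus field_simps)
        next
          case False
          hence pos: "0 < t * u\<^sup>2" "0 < u\<^sup>2" using t by (auto intro: mult_pos_pos)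
          have "1 / (1288 * t) = u\<^sup>2 / (320 * (t * u\<^sup>2) + 2 * t * u\<^sup>2) / 4"
            using t pos by (simp add: field_simps)
          also have "\<dots> \<le> y / 4"
            unfolding y_def using False pos den by (intro divide_right_mono divide_left_mono add_right_mono) auto
          finally have "exp (- (y / 4)) \<le> exp (- (1 / (1288 * t)))" by simp
          also have "\<dots> \<le> 6 / (1 / (1288 * t)) ^ 3" using t by (intro exp_minus_le_6_div_cube) auto
          also have "\<dots> = 6 * 1288 ^ 3 * t ^ 3" using t by (simp add: power_divide power_mult_distrib)
          also have "\<dots> \<le> 6 * 1288 ^ 3 * (321 / (1 + u\<^sup>2))"
          proof (intro mult_left_mono)
            have "\<bar>u\<bar> / sqrt V \<le> pi" using u V by (simp add: V_def abs_divide)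
            hence "\<bar>u\<bar> \<le> pi * sqrt V" using V by (simp add: field_simps)
            hence "\<bar>u\<bar>\<^sup>2 \<le> (pi * sqrt V)\<^sup>2" by (intro power_mono) auto
            hence "u\<^sup>2 \<le> pi\<^sup>2 * V" using V by (simp add: power_mult_distrib)
            hence "t ^ 3 * u\<^sup>2 \<le> t ^ 3 * (pi\<^sup>2 * V)" using t by (intro mult_left_mono) auto
            also have "\<dots> = pi\<^sup>2 * (V * t ^ 3)" by simp
            also have "\<dots> \<le> 10 * 32" using pi10 V32 V t by (intro mult_mono) auto
            finally have "t ^ 3 * u\<^sup>2 \<le> 320" by simp
            moreover have "t ^ 3 \<le> 1" using t by (intro power_le_one) auto
            ultimately have "t ^ 3 * (1 + u\<^sup>2) \<le> 321" by (simp add: distrib_left)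
            thus "t ^ 3 \<le> 321 / (1 + u\<^sup>2)" using u0 by (simp add: field_simps)
          qed auto
          finally show ?thesis by simp
        qed
      qed auto
      finally show "norm (pair_char N c (u / sqrt (sum_var N)) (x * sqrt (temp N))) \<le> dom_const c / (1 + u\<^sup>2)"
        by (simp add: dom_const_def th_def V_def t_def)
    qed
  qed
qed

section \<open>Coefficient extraction\<close>

definition pair_sum :: "nat \<Rightarrow> nat \<Rightarrow> real \<Rightarrow> complex" where
  "pair_sum c n \<alpha> = (\<Sum>p\<in>pairs c n. cis (\<alpha> * of_int (rank_diff p)))"

text \<open>The partition function of all pairs with elements in \<open>{c<..N}\<close>, each
  weighted by \<open>exp (- temp N)\<close> to the power of its total size. The square accounts for
  \<open>L\<close> and \<open>R\<close>.\<close>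

definition weight :: "nat \<Rightarrow> nat \<Rightarrow> real" where
  "weight N c = (\<Prod>j\<in>{c<..N}. (1 + exp (- (temp N * real j)))\<^sup>2)"

lemma prod_one_plus_eq_sum_Pow:
  fixes z w :: complex
  assumes "finite A"
  shows "(\<Prod>j\<in>A. 1 + w * z ^ j) = (\<Sum>X\<in>Pow A. w ^ card X * z ^ (\<Sum>X))"
proof -
  have "(\<Prod>j\<in>A. 1 + w * z ^ j) = (\<Prod>j\<in>A. w * z ^ j + 1)" by (simp add: add.commute)
  also have "\<dots> = (\<Sum>X\<in>Pow A. (\<Prod>j\<in>X. w * z ^ j) * (\<Prod>j\<in>A - X. 1))"
    by (rule prod_add[OF assms])
  also have "\<dots> = (\<Sum>X\<in>Pow A. w ^ card X * z ^ (\<Sum>X))"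
    by (intro sum.cong refl) (simp add: prod.distrib power_sum)
  finally show ?thesis .
qed

text \<open>Expanding the product chooses \<open>R\<close> through the factors with
  \<open>cis \<alpha>\<close> and \<open>L\<close> through those with
  \<open>cis (- \<alpha>)\<close>.\<close>

lemma generating_function:
  "(\<Prod>j\<in>{c<..N}. (1 + cis \<alpha> * z ^ j) * (1 + cis (- \<alpha>) * z ^ j))
     = (\<Sum>p\<in>Pow {c<..N} \<times> Pow {c<..N}. cis (\<alpha> * of_int (rank_diff p)) * z ^ (\<Sum>(fst p) + \<Sum>(snd p)))"
proof -
  let ?A = "{c<..N}"
  have "(\<Prod>j\<in>?A. (1 + cis \<alpha> * z ^ j) * (1 + cis (- \<alpha>) * z ^ j))
     = (\<Prod>j\<in>?A. 1 + cis (- \<alpha>) * z ^ j) * (\<Prod>j\<in>?A. 1 + cis \<alpha> * z ^ j)"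
    by (simp add: prod.distrib mult.commute)
  also have "\<dots> = (\<Sum>L\<in>Pow ?A. cis (- \<alpha>) ^ card L * z ^ (\<Sum>L)) * (\<Sum>R\<in>Pow ?A. cis \<alpha> ^ card R * z ^ (\<Sum>R))"
    by (subst (1 2) prod_one_plus_eq_sum_Pow) auto
  also have "\<dots> = (\<Sum>p\<in>Pow ?A \<times> Pow ?A. (cis (- \<alpha>) ^ card (fst p) * z ^ (\<Sum>(fst p))) * (cis \<alpha> ^ card (snd p) * z ^ (\<Sum>(snd p))))"
    by (simp add: sum_product sum.cartesian_product split_beta)
  also have "\<dots> = (\<Sum>p\<in>Pow ?A \<times> Pow ?A. cis (\<alpha> * of_int (rank_diff p)) * z ^ (\<Sum>(fst p) + \<Sum>(snd p)))"
  proof (intro sum.cong refl)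
    fix p
    have "cis (- \<alpha>) ^ card (fst p) * cis \<alpha> ^ card (snd p) = cis (\<alpha> * of_int (rank_diff p))"
      by (simp add: Complex.DeMoivre cis_mult rank_diff_def algebra_simps)
    thus "(cis (- \<alpha>) ^ card (fst p) * z ^ (\<Sum>(fst p))) * (cis \<alpha> ^ card (snd p) * z ^ (\<Sum>(snd p)))
      = cis (\<alpha> * of_int (rank_diff p)) * z ^ (\<Sum>(fst p) + \<Sum>(snd p))"
      by (simp add: power_add mult_ac)
  qed
  finally show ?thesis .
qed

text \<open>Multiplying a Bernoulli factor by \<open>1 + exp (- t j)\<close> clears the denominator
  of \<open>occ\<close> and leaves \<open>1 + cis b * z ^ j\<close> with
  \<open>z = exp (- t) cis \<theta>\<close>: the generating function on a circle.\<close>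

lemma pair_char_eq:
  "of_real (weight N c) * pair_char N c \<theta> \<alpha> =
     (\<Sum>p\<in>Pow {c<..N} \<times> Pow {c<..N}. cis (\<alpha> * of_int (rank_diff p)) *
        (of_real (exp (- temp N)) * cis \<theta>) ^ (\<Sum>(fst p) + \<Sum>(snd p)))"
proof -
  define t where "t = temp N"
  have fac: "of_real (1 + exp (- (t * real j))) * bern_char (occ t j) (real j * \<theta> + b)
     = 1 + cis b * (of_real (exp (- t)) * cis \<theta>) ^ j" for j b
  proof -
    have pos: "1 + exp (- (t * real j)) \<noteq> 0" by (metis add_pos_pos exp_gt_zero less_irrefl zero_less_one)
    have "of_real (1 + exp (- (t * real j))) * bern_char (occ t j) (real j * \<theta> + b)
       = of_real ((1 + exp (- (t * real j))) * (1 - occ t j)) + of_real ((1 + exp (- (t * real j))) * occ t j) * cis (real j * \<theta> + b)"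
      by (simp add: bern_char_def algebra_simps)
    also have "(1 + exp (- (t * real j))) * (1 - occ t j) = 1" unfolding one_minus_occ using pos by simp
    also have "(1 + exp (- (t * real j))) * occ t j = exp (- t) ^ j"
      using pos by (simp add: occ_def mult.commute flip: exp_of_nat_mult)
    also have "cis (real j * \<theta> + b) = cis b * cis \<theta> ^ j" by (simp add: Complex.DeMoivre cis_mult add.commute)
    finally show ?thesis by (simp add: power_mult_distrib mult_ac)
  qed
  have "of_real (weight N c) * pair_char N c \<theta> \<alpha> =
     (\<Prod>j\<in>{c<..N}. (of_real (1 + exp (- (t * real j))) * bern_char (occ t j) (real j * \<theta> + \<alpha>)) *
        (of_real (1 + exp (- (t * real j))) * bern_char (occ t j) (real j * \<theta> + (- \<alpha>))))"
    unfolding weight_def pair_char_def of_real_prod prod.distrib[symmetric] t_def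
    by (intro prod.cong refl) (simp add: power2_eq_square mult_ac)
  also have "\<dots> = (\<Prod>j\<in>{c<..N}. (1 + cis \<alpha> * (of_real (exp (- t)) * cis \<theta>) ^ j) * (1 + cis (- \<alpha>) * (of_real (exp (- t)) * cis \<theta>) ^ j))"
    unfolding fac ..
  finally show ?thesis unfolding generating_function t_def .
qed

lemma has_integral_cis:
  fixes k :: int
  shows "((\<lambda>\<theta>. cis (of_int k * \<theta>)) has_integral (if k = 0 then 2 * pi else 0)) {-pi..pi}"
proof (cases "k = 0")
  case True
  thus ?thesis using has_integral_const_real[of "1::complex" "-pi" pi] by (simp add: scaleR_conv_of_real)
next
  case False
  define F where "F = (\<lambda>\<theta>. cis (of_int k * \<theta>) / (\<i> * of_int k))"
  have "((\<lambda>\<theta>. cis (of_int k * \<theta>)) has_integral (F pi - F (- pi))) {-pi..pi}"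
  proof (rule fundamental_theorem_of_calculus)
    fix \<theta> :: real
    have "((\<lambda>z. exp (\<i> * of_int k * z) / (\<i> * of_int k)) has_field_derivative exp (\<i> * of_int k * of_real \<theta>)) (at (of_real \<theta>))"
      using False by (auto intro!: derivative_eq_intros)
    from has_vector_derivative_real_field[OF this]
    show "(F has_vector_derivative cis (of_int k * \<theta>)) (at \<theta> within {-pi..pi})"
      by (simp add: F_def cis_conv_exp mult.assoc)
  qed simp
  moreover have "cis (of_int k * pi) = cis (of_int k * (- pi))"
  proof -
    have one: "cis (2 * pi * of_int k) = 1" by (rule cis_multiple_2pi) simp
    have "cis (of_int k * pi) = cis (of_int k * (- pi)) * cis (2 * pi * of_int k)"
      unfolding cis_mult by (rule arg_cong[where f = cis]) (simp add: algebra_simps)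
    thus ?thesis unfolding one by simp
  qed
  hence "F pi - F (- pi) = 0" by (simp add: F_def)
  ultimately show ?thesis using False by simp
qed

text \<open>Cauchy's coefficient formula on the circle of radius \<open>exp (- temp N)\<close>:
  orthogonality of the functions \<open>cis (k \<theta>)\<close> keeps only pairs of total size
  \<open>n\<close>. The radius depends on \<open>N\<close> alone, so nearby sizes share one saddle
  point.\<close>

lemma has_integral_pair_char:
  assumes "n \<le> N"
  shows "((\<lambda>\<theta>. cis (- (real n * \<theta>)) * pair_char N c \<theta> \<alpha>) has_integral
     of_real (2 * pi * exp (- temp N) ^ n / weight N c) * pair_sum c n \<alpha>) {-pi..pi}"
proof -
  define A where "A = Pow {c<..N} \<times> Pow {c<..N}"
  define r where "r = exp (- temp N)"
  define m where "m = (\<lambda>p::nat set \<times> nat set. \<Sum>(fst p) + \<Sum>(snd p))"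
  have finA: "finite A" by (simp add: A_def)
  have w0: "weight N c \<noteq> 0"
    unfolding weight_def by (simp add: add_pos_pos less_imp_neq[symmetric])
  have "((\<lambda>\<theta>. \<Sum>p\<in>A. (cis (\<alpha> * of_int (rank_diff p)) * of_real (r ^ m p)) * cis (of_int (int (m p) - int n) * \<theta>)) has_integral
     (\<Sum>p\<in>A. (cis (\<alpha> * of_int (rank_diff p)) * of_real (r ^ m p)) * (if int (m p) - int n = 0 then 2 * pi else 0))) {-pi..pi}"
    by (intro has_integral_sum finA has_integral_mult_right has_integral_cis)
  also have "(\<lambda>\<theta>. \<Sum>p\<in>A. (cis (\<alpha> * of_int (rank_diff p)) * of_real (r ^ m p)) * cis (of_int (int (m p) - int n) * \<theta>))
    = (\<lambda>\<theta>. of_real (weight N c) * (cis (- (real n * \<theta>)) * pair_char N c \<theta> \<alpha>))"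
  proof
    fix \<theta>
    have "of_real (weight N c) * (cis (- (real n * \<theta>)) * pair_char N c \<theta> \<alpha>) = cis (- (real n * \<theta>)) * (of_real (weight N c) * pair_char N c \<theta> \<alpha>)"
      by (simp add: mult_ac)
    also have "\<dots> = (\<Sum>p\<in>A. cis (- (real n * \<theta>)) * (cis (\<alpha> * of_int (rank_diff p)) * (of_real r * cis \<theta>) ^ m p))"
      unfolding pair_char_eq sum_distrib_left A_def m_def r_def ..
    also have "\<dots> = (\<Sum>p\<in>A. (cis (\<alpha> * of_int (rank_diff p)) * of_real (r ^ m p)) * cis (of_int (int (m p) - int n) * \<theta>))"
    proof (intro sum.cong refl)
      fix p
      have "cis (of_int (int (m p) - int n) * \<theta>) = cis (- (real n * \<theta>)) * cis \<theta> ^ m p"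
        by (simp add: Complex.DeMoivre cis_mult algebra_simps)
      thus "cis (- (real n * \<theta>)) * (cis (\<alpha> * of_int (rank_diff p)) * (of_real r * cis \<theta>) ^ m p)
        = (cis (\<alpha> * of_int (rank_diff p)) * of_real (r ^ m p)) * cis (of_int (int (m p) - int n) * \<theta>)"
        by (simp add: power_mult_distrib mult_ac)
    qed
    finally show "(\<Sum>p\<in>A. (cis (\<alpha> * of_int (rank_diff p)) * of_real (r ^ m p)) * cis (of_int (int (m p) - int n) * \<theta>))
       = of_real (weight N c) * (cis (- (real n * \<theta>)) * pair_char N c \<theta> \<alpha>)" ..
  qed
  also have "(\<Sum>p\<in>A. (cis (\<alpha> * of_int (rank_diff p)) * of_real (r ^ m p)) * (if int (m p) - int n = 0 then 2 * pi else 0))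
     = of_real (2 * pi * r ^ n) * pair_sum c n \<alpha>"
  proof -
    have "(\<Sum>p\<in>A. (cis (\<alpha> * of_int (rank_diff p)) * of_real (r ^ m p)) * (if int (m p) - int n = 0 then 2 * pi else 0))
       = (\<Sum>p\<in>A. if m p = n then of_real (2 * pi * r ^ n) * cis (\<alpha> * of_int (rank_diff p)) else 0)"
      by (intro sum.cong refl) auto
    also have "\<dots> = (\<Sum>p\<in>{p\<in>A. m p = n}. of_real (2 * pi * r ^ n) * cis (\<alpha> * of_int (rank_diff p)))"
      by (rule sum.inter_filter[OF finA, symmetric])
    also have "{p\<in>A. m p = n} = pairs c n"
      unfolding pairs_eq[OF assms] A_def m_def ..
    finally show ?thesis by (simp add: pair_sum_def sum_distrib_left)
  qed
  finally have "((\<lambda>\<theta>. of_real (1 / weight N c) * (of_real (weight N c) * (cis (- (real n * \<theta>)) * pair_char N c \<theta> \<alpha>))) has_integral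
     of_real (1 / weight N c) * (of_real (2 * pi * r ^ n) * pair_sum c n \<alpha>)) {-pi..pi}"
    by (rule has_integral_mult_right)
  thus ?thesis using w0 by (simp add: r_def field_simps)
qed

section \<open>The rescaled Fourier integral and its limit\<close>

lemma continuous_on_pair_char [continuous_intros]:
  "continuous_on A f \<Longrightarrow> continuous_on A (\<lambda>x. pair_char N c (f x) \<alpha>)"
  unfolding pair_char_def bern_char_def by (intro continuous_intros)

text \<open>\<open>u\<close> is the frequency in units of the inverse standard deviation of the
  total size. The indicator extends the integrals for all \<open>N\<close> to the whole line, as
  dominated convergence requires. The target size is \<open>N - k\<close>, while the saddle point
  stays that of \<open>N\<close>.\<close>

definition scaled_integrand :: "nat \<Rightarrow> nat \<Rightarrow> real \<Rightarrow> nat \<Rightarrow> real \<Rightarrow> complex" where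
  "scaled_integrand c k x N u = indicator {-pi..pi} (u / sqrt (sum_var N)) *\<^sub>R
     (cis (- (real (N - k) * (u / sqrt (sum_var N)))) * pair_char N c (u / sqrt (sum_var N)) (x * sqrt (temp N)))"

lemma integral_scaled_integrand:
  assumes "k \<le> N" "0 < sum_var N"
  shows "(\<integral>u. scaled_integrand c k x N u \<partial>lborel) = of_real (sqrt (sum_var N) * (2 * pi * exp (- temp N) ^ (N - k) / weight N c))
           * pair_sum c (N - k) (x * sqrt (temp N))"
proof -
  define s where "s = sqrt (sum_var N)"
  have s: "0 < s" using assms by (simp add: s_def)
  define g where "g = (\<lambda>\<theta>. cis (- (real (N - k) * \<theta>)) * pair_char N c \<theta> (x * sqrt (temp N)))"
  have cont: "continuous_on {-pi..pi} g"
    unfolding g_def by (intro continuous_intros)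
  have int: "set_integrable lborel {-pi..pi} g"
    unfolding set_integrable_def using borel_integrable_atLeastAtMost'[OF cont] by (simp add: set_integrable_def)
  \<comment> \<open>The argument \<open>u / s\<close> is written as an affine map to prepare the
    substitution.\<close>
  have "(\<integral>u. scaled_integrand c k x N u \<partial>lborel) = (\<integral>u. indicator {-pi..pi} (0 + (1 / s) * u) *\<^sub>R g (0 + (1 / s) * u) \<partial>lborel)"
    unfolding scaled_integrand_def g_def s_def by simp
  also have "\<dots> = s *\<^sub>R (\<bar>1 / s\<bar> *\<^sub>R (\<integral>u. indicator {-pi..pi} (0 + (1 / s) * u) *\<^sub>R g (0 + (1 / s) * u) \<partial>lborel))"
    using s by simp
  also have "\<bar>1 / s\<bar> *\<^sub>R (\<integral>u. indicator {-pi..pi} (0 + (1 / s) * u) *\<^sub>R g (0 + (1 / s) * u) \<partial>lborel) = (\<integral>\<theta>. indicator {-pi..pi} \<theta> *\<^sub>R g \<theta> \<partial>lborel)"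
    using s by (intro lborel_integral_real_affine[symmetric]) auto
  also have "\<dots> = integral {-pi..pi} g"
    using set_borel_integral_eq_integral(2)[OF int] by (simp add: set_lebesgue_integral_def)
  also have "\<dots> = of_real (2 * pi * exp (- temp N) ^ (N - k) / weight N c) * pair_sum c (N - k) (x * sqrt (temp N))"
    unfolding g_def by (intro integral_unique has_integral_pair_char) simp
  finally show ?thesis by (simp add: s_def scaleR_conv_of_real)
qed

lemma temp_tendsto_0: "temp \<longlonglongrightarrow> 0"
  using temp_at_right_0 by (simp add: filterlim_at)

lemma theta_tendsto_0: "(\<lambda>N. u / sqrt (sum_var N)) \<longlonglongrightarrow> 0"
proof (rule Lim_null_comparison)
  show "\<forall>\<^sub>F N in sequentially. norm (u / sqrt (sum_var N)) \<le> 15 * \<bar>u\<bar> * temp N powr (3/2)"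
    using eventually_theta_le by eventually_elim (simp only: real_norm_def)
  have "(\<lambda>N. temp N powr (3/2)) \<longlonglongrightarrow> 0"
    unfolding temp_def by real_asymp
  thus "(\<lambda>N. 15 * \<bar>u\<bar> * temp N powr (3/2)) \<longlonglongrightarrow> 0" by (rule tendsto_mult_right_zero)
qed

lemma alpha_tendsto_0: "(\<lambda>N. x * sqrt (temp N)) \<longlonglongrightarrow> 0"
  using tendsto_mult_right_zero[OF tendsto_real_sqrt[OF temp_tendsto_0, simplified]] .

lemma bern_char_occ_tendsto:
  assumes "y \<longlonglongrightarrow> 0"
  shows "(\<lambda>N. bern_char (occ (temp N) j) (y N)) \<longlonglongrightarrow> 1"
proof -
  have "(\<lambda>N. exp (- (temp N * real j)) / (1 + exp (- (temp N * real j)))) \<longlonglongrightarrow> exp (- (0 * real j)) / (1 + exp (- (0 * real j)))"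
    by (intro tendsto_intros temp_tendsto_0) simp
  hence p: "(\<lambda>N. occ (temp N) j) \<longlonglongrightarrow> 1 / 2" by (simp add: occ_def)
  have "(\<lambda>N. bern_char (occ (temp N) j) (y N)) \<longlonglongrightarrow> of_real (1 - 1 / 2) + of_real (1 / 2) * cis 0"
    unfolding bern_char_def by (intro tendsto_intros tendsto_cis p assms)
  thus ?thesis by simp
qed

text \<open>Reduces to \<open>pair_char_tendsto\<close>, the case \<open>c = k = 0\<close>: the
  finitely many factors with \<open>j\<close> up to \<open>c\<close> tend to 1, and so does the
  phase from the shift by \<open>k\<close>, because both frequencies tend to 0.\<close>

lemma scaled_integrand_tendsto:
  "(\<lambda>N. scaled_integrand c k x N u) \<longlonglongrightarrow> of_real (exp (- (u\<^sup>2 + x\<^sup>2) / 2))"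
proof -
  define th where "th = (\<lambda>N. u / sqrt (sum_var N))"
  define al where "al = (\<lambda>N. x * sqrt (temp N))"
  have th: "th \<longlonglongrightarrow> 0" and al: "al \<longlonglongrightarrow> 0"
    unfolding th_def al_def by (rule theta_tendsto_0 alpha_tendsto_0)+
  define P where "P = (\<lambda>N. \<Prod>j\<in>{0<..c}. bern_char (occ (temp N) j) (real j * th N + al N) * bern_char (occ (temp N) j) (real j * th N - al N))"
  have "P \<longlonglongrightarrow> (\<Prod>j\<in>{0<..c}. 1 * 1)"
  proof -
    have "(\<lambda>N. real j * th N + al N) \<longlonglongrightarrow> real j * 0 + 0" "(\<lambda>N. real j * th N - al N) \<longlonglongrightarrow> real j * 0 - 0" for j
      by (intro tendsto_intros th al)+
    thus ?thesis unfolding P_def by (intro tendsto_prod tendsto_mult bern_char_occ_tendsto) simp_all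
  qed
  hence P: "P \<longlonglongrightarrow> 1" by simp
  have "(\<lambda>N. cis (- (real N * th N)) * pair_char N 0 (th N) (al N) * cis (real k * th N) / P N)
     \<longlonglongrightarrow> of_real (exp (- (u\<^sup>2 + x\<^sup>2) / 2)) * cis (real k * 0) / 1"
    unfolding th_def al_def
    by (intro tendsto_divide tendsto_mult pair_char_tendsto tendsto_cis tendsto_const theta_tendsto_0 P[unfolded th_def al_def]) simp
  hence lim: "(\<lambda>N. cis (- (real N * th N)) * pair_char N 0 (th N) (al N) * cis (real k * th N) / P N)
     \<longlonglongrightarrow> of_real (exp (- (u\<^sup>2 + x\<^sup>2) / 2))" by simp
  have "\<forall>\<^sub>F N in sequentially. P N \<noteq> 0"
    using P by (rule tendsto_imp_eventually_ne) simp
  moreover have "\<forall>\<^sub>F N in sequentially. \<bar>th N\<bar> < pi"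
    using tendsto_rabs_zero[OF th] by (rule order_tendstoD) simp
  ultimately have "\<forall>\<^sub>F N in sequentially. cis (- (real N * th N)) * pair_char N 0 (th N) (al N) * cis (real k * th N) / P N = scaled_integrand c k x N u"
    using eventually_ge_at_top[of "max c k"]
  proof eventually_elim
    case (elim N)
    have "{0<..N} = {0<..c} \<union> {c<..N}" "{0<..c} \<inter> {c<..N} = {}" using elim by auto
    hence "pair_char N 0 (th N) (al N) = P N * pair_char N c (th N) (al N)"
      unfolding pair_char_def P_def by (simp add: prod.union_disjoint)
    hence "cis (- (real N * th N)) * pair_char N 0 (th N) (al N) * cis (real k * th N) / P N
       = (cis (- (real N * th N)) * cis (real k * th N)) * pair_char N c (th N) (al N)"
      using elim by simp
    moreover have "cis (- (real N * th N)) * cis (real k * th N) = cis (- (real (N - k) * th N))"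
      using elim by (simp add: cis_mult of_nat_diff algebra_simps)
    moreover have "indicator {-pi..pi} (th N) = (1::real)" using elim by (simp add: abs_less_iff)
    ultimately show ?case
      unfolding scaled_integrand_def by (simp add: th_def al_def)
  qed
  with lim show ?thesis by (rule Lim_transform_eventually)
qed

lemma integral_gaussian: "(\<integral>u. exp (- (u\<^sup>2 + x\<^sup>2) / 2) \<partial>lborel) = sqrt (2 * pi) * exp (- x\<^sup>2 / 2)"
proof -
  have "exp (- (u\<^sup>2 + x\<^sup>2) / 2) = (sqrt (2 * pi) * exp (- x\<^sup>2 / 2)) * std_normal_density u" for u
    by (simp add: std_normal_density_def mult_ac diff_divide_distrib flip: exp_add)
  thus ?thesis by simp
qed

lemma integral_scaled_integrand_tendsto:
  "(\<lambda>N. \<integral>u. scaled_integrand c k x N u \<partial>lborel) \<longlonglongrightarrow> of_real (sqrt (2 * pi) * exp (- x\<^sup>2 / 2))"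
proof -
  obtain N0 where N0: "\<And>N u. N0 \<le> N \<Longrightarrow> \<bar>u / sqrt (sum_var N)\<bar> \<le> pi \<Longrightarrow>
     norm (pair_char N c (u / sqrt (sum_var N)) (x * sqrt (temp N))) \<le> dom_const c / (1 + u\<^sup>2)"
    using eventually_pair_char_dominated[of c x] unfolding eventually_sequentially by blast
  have dom0: "0 \<le> dom_const c" by (simp add: dom_const_def)
  \<comment> \<open>Starting at \<open>N0\<close> makes the domination hold for every index.\<close>
  have "(\<lambda>i. \<integral>u. scaled_integrand c k x (i + N0) u \<partial>lborel) \<longlonglongrightarrow> (\<integral>u. complex_of_real (exp (- (u\<^sup>2 + x\<^sup>2) / 2)) \<partial>lborel)"
  proof (rule integral_dominated_convergence)
    show "integrable lborel (\<lambda>u. dom_const c * inverse (1 + u\<^sup>2))"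
      using integrable_inverse_1_plus_square by (intro integrable_mult_right) (simp add: set_integrable_def)
    show "AE u in lborel. (\<lambda>i. scaled_integrand c k x (i + N0) u) \<longlonglongrightarrow> complex_of_real (exp (- (u\<^sup>2 + x\<^sup>2) / 2))"
      using LIMSEQ_ignore_initial_segment[OF scaled_integrand_tendsto] by (intro AE_I2)
    show "AE u in lborel. norm (scaled_integrand c k x (i + N0) u) \<le> dom_const c * inverse (1 + u\<^sup>2)" for i
    proof (intro AE_I2)
      fix u
      have "0 \<le> dom_const c * inverse (1 + u\<^sup>2)" using dom0 by simp
      moreover have "norm (pair_char (i + N0) c (u / sqrt (sum_var (i + N0))) (x * sqrt (temp (i + N0)))) \<le> dom_const c * inverse (1 + u\<^sup>2)"
        if "u / sqrt (sum_var (i + N0)) \<in> {-pi..pi}"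
        using N0[of "i + N0" u] that by (simp add: abs_le_iff divide_inverse)
      ultimately show "norm (scaled_integrand c k x (i + N0) u) \<le> dom_const c * inverse (1 + u\<^sup>2)"
        unfolding scaled_integrand_def by (auto simp: norm_mult indicator_def simp del: atLeastAtMost_iff)
    qed
    show "scaled_integrand c k x (i + N0) \<in> borel_measurable lborel" for i
      unfolding scaled_integrand_def pair_char_def bern_char_def cis_conv_exp by measurable
  qed measurable
  also have "(\<integral>u. complex_of_real (exp (- (u\<^sup>2 + x\<^sup>2) / 2)) \<partial>lborel) = of_real (sqrt (2 * pi) * exp (- x\<^sup>2 / 2))"
    by (simp only: integral_complex_of_real integral_gaussian)
  finally show ?thesis by (rule LIMSEQ_offset)
qed

text \<open>Only the existence of a common normalisation matters, as it cancels in the ratio.\<close>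
definition norm_factor :: "nat \<Rightarrow> real" where
  "norm_factor N = sqrt (sum_var N) * (2 * pi * exp (- temp N) ^ N / weight N 0)"

text \<open>Passing from \<open>weight N 0\<close> to \<open>weight N c\<close> removes
  \<open>c\<close> factors, each tending to 4. The shift by \<open>k\<close> contributes only
  \<open>exp (- temp N) ^ k\<close>, which tends to 1.\<close>

lemma norm_factor_pair_sum_tendsto:
  "(\<lambda>N. of_real (norm_factor N) * pair_sum c (N - k) (x * sqrt (temp N)))
     \<longlonglongrightarrow> of_real (sqrt (2 * pi) * exp (- x\<^sup>2 / 2) / 4 ^ c)"
proof -
  define W where "W = (\<lambda>N. \<Prod>j\<in>{0<..c}. (1 + exp (- (temp N * real j)))\<^sup>2)"
  have "W \<longlonglongrightarrow> (\<Prod>j\<in>{0<..c}. (1 + exp (- (0 * real j)))\<^sup>2)"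
    unfolding W_def by (intro tendsto_intros temp_tendsto_0)
  hence W: "W \<longlonglongrightarrow> 4 ^ c" by simp
  have "(\<lambda>N. exp (- temp N) ^ k / W N) \<longlonglongrightarrow> exp (- 0) ^ k / 4 ^ c"
    by (intro tendsto_intros temp_tendsto_0 W) simp
  hence r: "(\<lambda>N. complex_of_real (exp (- temp N) ^ k / W N)) \<longlonglongrightarrow> of_real (1 / 4 ^ c)"
    by (intro tendsto_of_real) simp
  have "(\<lambda>N. of_real (exp (- temp N) ^ k / W N) * (\<integral>u. scaled_integrand c k x N u \<partial>lborel))
     \<longlonglongrightarrow> of_real (1 / 4 ^ c) * of_real (sqrt (2 * pi) * exp (- x\<^sup>2 / 2))"
    by (intro tendsto_mult r integral_scaled_integrand_tendsto)
  moreover have "\<forall>\<^sub>F N in sequentially. of_real (exp (- temp N) ^ k / W N) * (\<integral>u. scaled_integrand c k x N u \<partial>lborel)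
     = of_real (norm_factor N) * pair_sum c (N - k) (x * sqrt (temp N))"
    using eventually_theta_le eventually_ge_at_top[of "max c k"]
  proof eventually_elim
    case (elim N)
    have "{0<..N} = {0<..c} \<union> {c<..N}" "{0<..c} \<inter> {c<..N} = {}" using elim by auto
    hence w: "weight N 0 = W N * weight N c"
      unfolding weight_def W_def by (simp add: prod.union_disjoint)
    have "exp (- temp N) ^ N = exp (- temp N) ^ k * exp (- temp N) ^ (N - k)"
      using elim by (simp flip: power_add)
    hence "norm_factor N = exp (- temp N) ^ k / W N * (sqrt (sum_var N) * (2 * pi * exp (- temp N) ^ (N - k) / weight N c))"
      unfolding norm_factor_def w by simp
    thus ?case using elim by (subst integral_scaled_integrand) auto
  qed
  ultimately show ?thesis by (rule Lim_transform_eventually[THEN tendsto_eq_rhs]) simp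
qed

section \<open>The limit law\<close>

text \<open>Three errors of size \<open>e / 3\<close> exchange the limits in \<open>C\<close> and
  \<open>n\<close>. The error bound for fixed \<open>C\<close> need not vanish; only its limit
  \<open>B C\<close> has to become small as \<open>C\<close> grows.\<close>

lemma tendsto_by_approximation:
  fixes f :: "nat \<Rightarrow> 'a :: real_normed_vector"
  assumes approx: "\<And>C. \<forall>\<^sub>F n in sequentially. norm (f n - a C n) \<le> b C n"
    and a: "\<And>C. a C \<longlonglongrightarrow> A C" and b: "\<And>C. b C \<longlonglongrightarrow> B C"
    and A: "A \<longlonglongrightarrow> L" and B: "B \<longlonglongrightarrow> (0::real)"
  shows "f \<longlonglongrightarrow> L"
proof (rule tendstoI)
  fix e :: real assume e: "0 < e"
  have "\<forall>\<^sub>F C in sequentially. dist (A C) L < e / 3 \<and> B C < e / 3"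
    using tendstoD[OF A, of "e / 3"] order_tendstoD(2)[OF B, of "e / 3"] e by (intro eventually_conj) auto
  then obtain C where C: "dist (A C) L < e / 3" "B C < e / 3"
    by (auto dest: eventually_happens)
  have "\<forall>\<^sub>F n in sequentially. dist (a C n) (A C) < e / 3"
    using tendstoD[OF a, of "e / 3"] e by auto
  moreover have "\<forall>\<^sub>F n in sequentially. b C n < e / 3"
    using order_tendstoD(2)[OF b C(2)] .
  ultimately show "\<forall>\<^sub>F n in sequentially. dist (f n) L < e"
    using approx[of C]
  proof eventually_elim
    case (elim n)
    have "dist (f n) L \<le> dist (f n) (a C n) + dist (a C n) (A C) + dist (A C) L"
      by (meson add_mono_thms_linordered_semiring(3) dist_triangle order.trans)
    thus ?case using elim C by (simp add: dist_norm)
  qed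
qed

definition rank_char_sum :: "nat \<Rightarrow> real \<Rightarrow> complex" where
  "rank_char_sum N \<alpha> = (\<Sum>xs\<in>Vd_set N. cis (\<alpha> * of_int (rk xs)))"

lemma rank_char_sum_eq: "rank_char_sum N \<alpha> = (\<Sum>c\<le>N. pair_sum c (N - c) \<alpha>)"
  unfolding rank_char_sum_def pair_sum_def by (rule sum_Vd_set)

lemma norm_pair_sum_le: "norm (pair_sum c n \<alpha>) \<le> real (card (pairs c n))"
  unfolding pair_sum_def by (rule order.trans[OF norm_sum]) simp

lemma pair_sum_0: "pair_sum c n 0 = of_nat (card (pairs c n))"
  by (simp add: pair_sum_def)

lemma norm_factor_nonneg: "0 \<le> norm_factor N"
proof -
  have "0 \<le> sum_var N" unfolding sum_var_def using occ_var_bounds(1) by (auto intro!: sum_nonneg)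
  moreover have "0 \<le> weight N 0" unfolding weight_def by (intro prod_nonneg) auto
  ultimately show ?thesis by (simp add: norm_factor_def)
qed

text \<open>Each \<open>c\<close> up to \<open>C\<close> contributes \<open>G / 4 ^ c\<close>, and
  the geometric series gives the \<open>4 / 3\<close>. Central parts above \<open>C\<close> are
  handled by \<open>card_pairs_tail\<close>, whose bound, once normalised, tends to
  \<open>sqrt (2 * pi) / 4 ^ C\<close>.\<close>

lemma norm_factor_rank_char_sum_tendsto:
  "(\<lambda>N. of_real (norm_factor N) * rank_char_sum N (x * sqrt (temp N)))
     \<longlonglongrightarrow> of_real (4 / 3 * (sqrt (2 * pi) * exp (- x\<^sup>2 / 2)))"
proof -
  define G where "G = sqrt (2 * pi) * exp (- x\<^sup>2 / 2)"
  define al where "al = (\<lambda>N. x * sqrt (temp N))"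
  have "(\<lambda>N. of_real (norm_factor N) * rank_char_sum N (al N)) \<longlonglongrightarrow> of_real (4 / 3 * G)"
  proof (rule tendsto_by_approximation[where
        a = "\<lambda>C N. \<Sum>c\<le>C. of_real (norm_factor N) * pair_sum c (N - c) (al N)" and
        A = "\<lambda>C. \<Sum>c\<le>C. of_real (G / 4 ^ c)" and
        b = "\<lambda>C N. norm_factor N * real (card (pairs C N))" and
        B = "\<lambda>C. sqrt (2 * pi) / 4 ^ C"])
    fix C
    show "(\<lambda>N. \<Sum>c\<le>C. of_real (norm_factor N) * pair_sum c (N - c) (al N)) \<longlonglongrightarrow> (\<Sum>c\<le>C. of_real (G / 4 ^ c))"
      unfolding al_def G_def by (intro tendsto_sum norm_factor_pair_sum_tendsto)
    \<comment> \<open>At angle 0 the sum \<open>pair_sum\<close> is a count, so the limit with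
      \<open>x = 0\<close> and \<open>k = 0\<close> applies.\<close>
    show "(\<lambda>N. norm_factor N * real (card (pairs C N))) \<longlonglongrightarrow> sqrt (2 * pi) / 4 ^ C"
      using tendsto_Re[OF norm_factor_pair_sum_tendsto[of C 0 0]] by (simp add: pair_sum_0)
    show "\<forall>\<^sub>F N in sequentially. norm (of_real (norm_factor N) * rank_char_sum N (al N) -
        (\<Sum>c\<le>C. of_real (norm_factor N) * pair_sum c (N - c) (al N))) \<le> norm_factor N * real (card (pairs C N))"
      using eventually_ge_at_top[of C]
    proof eventually_elim
      case (elim N)
      have "{..N} = {..C} \<union> {C<..N}" "{..C} \<inter> {C<..N} = {}" using elim by auto
      hence "rank_char_sum N (al N) = (\<Sum>c\<le>C. pair_sum c (N - c) (al N)) + (\<Sum>c\<in>{C<..N}. pair_sum c (N - c) (al N))"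
        unfolding rank_char_sum_eq by (simp add: sum.union_disjoint)
      hence "of_real (norm_factor N) * rank_char_sum N (al N) - (\<Sum>c\<le>C. of_real (norm_factor N) * pair_sum c (N - c) (al N))
         = of_real (norm_factor N) * (\<Sum>c\<in>{C<..N}. pair_sum c (N - c) (al N))"
        by (simp add: distrib_left sum_distrib_left)
      also have "norm \<dots> = norm_factor N * norm (\<Sum>c\<in>{C<..N}. pair_sum c (N - c) (al N))"
        using norm_factor_nonneg[of N] by (simp add: norm_mult)
      also have "\<dots> \<le> norm_factor N * real (card (pairs C N))"
      proof (intro mult_left_mono norm_factor_nonneg)
        have "norm (\<Sum>c\<in>{C<..N}. pair_sum c (N - c) (al N)) \<le> (\<Sum>c\<in>{C<..N}. real (card (pairs c (N - c))))"
          by (intro sum_norm_le norm_pair_sum_le)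
        also have "\<dots> \<le> real (card (pairs C N))"
          using card_pairs_tail[of N C] by (simp flip: of_nat_sum)
        finally show "norm (\<Sum>c\<in>{C<..N}. pair_sum c (N - c) (al N)) \<le> real (card (pairs C N))" .
      qed
      finally show ?case .
    qed
  next
    have "(\<lambda>c. G * (1 / 4) ^ c) sums (G * (1 / (1 - 1 / 4)))"
      by (intro sums_mult geometric_sums) simp
    hence "(\<lambda>C. \<Sum>c\<le>C. G * (1 / 4) ^ c) \<longlonglongrightarrow> 4 / 3 * G" by (simp add: sums_def_le mult.commute)
    hence "(\<lambda>C. complex_of_real (\<Sum>c\<le>C. G * (1 / 4) ^ c)) \<longlonglongrightarrow> of_real (4 / 3 * G)" by (rule tendsto_of_real)
    thus "(\<lambda>C. \<Sum>c\<le>C. complex_of_real (G / 4 ^ c)) \<longlonglongrightarrow> of_real (4 / 3 * G)"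
      by (simp add: power_divide)
    show "(\<lambda>C. sqrt (2 * pi) / 4 ^ C) \<longlonglongrightarrow> 0" by real_asymp
  qed
  thus ?thesis by (simp only: al_def G_def)
qed

text \<open>Divide the previous limit by its case \<open>x = 0\<close>, where the sum counts all
  compositions: \<open>norm_factor N\<close> and the constant \<open>4 / 3 * sqrt (2 * pi)\<close>
  cancel. The latter is nonzero, so the denominator eventually is too.\<close>

lemma rank_char_tendsto:
  "(\<lambda>N. rank_char_sum N (x * sqrt (temp N)) / of_nat (Vd N)) \<longlonglongrightarrow> of_real (exp (- x\<^sup>2 / 2))"
proof -
  have V: "rank_char_sum N 0 = of_nat (Vd N)" for N
    by (simp add: rank_char_sum_def Vd_def)
  have 0: "(\<lambda>N. of_real (norm_factor N) * complex_of_real (real (Vd N))) \<longlonglongrightarrow> of_real (4 / 3 * sqrt (2 * pi))"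
    using norm_factor_rank_char_sum_tendsto[of 0] by (simp add: V)
  have "(\<lambda>N. (of_real (norm_factor N) * rank_char_sum N (x * sqrt (temp N))) / (of_real (norm_factor N) * complex_of_real (real (Vd N))))
     \<longlonglongrightarrow> of_real (4 / 3 * (sqrt (2 * pi) * exp (- x\<^sup>2 / 2))) / of_real (4 / 3 * sqrt (2 * pi))"
    by (intro tendsto_divide norm_factor_rank_char_sum_tendsto 0) simp
  hence "(\<lambda>N. (of_real (norm_factor N) * rank_char_sum N (x * sqrt (temp N))) / (of_real (norm_factor N) * complex_of_real (real (Vd N))))
     \<longlonglongrightarrow> of_real (exp (- x\<^sup>2 / 2))" by simp
  moreover have "\<forall>\<^sub>F N in sequentially. of_real (norm_factor N) * complex_of_real (real (Vd N)) \<noteq> 0"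
    using 0 by (rule tendsto_imp_eventually_ne) simp
  hence "\<forall>\<^sub>F N in sequentially. (of_real (norm_factor N) * rank_char_sum N (x * sqrt (temp N))) / (of_real (norm_factor N) * complex_of_real (real (Vd N)))
     = rank_char_sum N (x * sqrt (temp N)) / of_nat (Vd N)"
    by eventually_elim simp
  ultimately show ?thesis by (rule Lim_transform_eventually)
qed

section \<open>From characteristic functions to distribution functions\<close>

lemma cdf_std_normal:
  "cdf std_normal_distribution x = (1 / sqrt (2 * pi)) * integral {..x} (\<lambda>t. exp (- (t\<^sup>2) / 2))"
proof -
  interpret real_distribution std_normal_distribution by (rule real_dist_normal_dist)
  have "cdf std_normal_distribution x = (\<integral>t. indicator {..x} t \<partial>std_normal_distribution)"
    by (simp add: cdf_def2)
  also have "\<dots> = (\<integral>t. std_normal_density t *\<^sub>R indicator {..x} t \<partial>lborel)"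
    by (rule integral_density) auto
  also have "\<dots> = (LINT t:{..x}|lborel. std_normal_density t)"
    by (simp add: set_lebesgue_integral_def mult.commute)
  also have "\<dots> = integral {..x} std_normal_density"
  proof (rule set_borel_integral_eq_integral)
    show "set_integrable lborel {..x} std_normal_density"
      unfolding set_integrable_def by (rule integrable_mult_indicator) auto
  qed
  also have "\<dots> = (1 / sqrt (2 * pi)) * integral {..x} (\<lambda>t. exp (- (t\<^sup>2) / 2))"
    unfolding std_normal_density_def by (rule integral_mult_right)
  finally show ?thesis .
qed

text \<open>A measure with a density charges no point. Continuity matters because weak convergence
  yields convergence of distribution functions at continuity points of the limit.\<close>

lemma isCont_cdf_std_normal: "isCont (cdf std_normal_distribution) x"
proof -
  interpret real_distribution std_normal_distribution by (rule real_dist_normal_dist)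
  have "emeasure std_normal_distribution {x} = 0"
    by (subst emeasure_density) (auto simp: nn_integral_0_iff_AE intro!: AE_mp[OF AE_lborel_singleton[of x]])
  thus ?thesis unfolding isCont_cdf by (simp add: measure_def)
qed

definition rank_distr :: "nat \<Rightarrow> real measure" where
  "rank_distr N = distr (measure_pmf (pmf_of_set (Vd_set N))) borel
     (\<lambda>c. real_of_int (rk c) / (6 * real N / pi\<^sup>2) powr (1/4))"

lemma real_distribution_rank_distr: "real_distribution (rank_distr N)"
  unfolding rank_distr_def by (rule prob_space.real_distribution_distr[OF prob_space_measure_pmf]) simp

lemma cdf_rank_distr:
  "cdf (rank_distr N) x = real (card {c\<in>Vd_set N. real_of_int (rk c) / (6 * real N / pi\<^sup>2) powr (1/4) \<le> x}) / real (Vd N)"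
proof -
  have "cdf (rank_distr N) x = measure (measure_pmf (pmf_of_set (Vd_set N)))
     {c. real_of_int (rk c) / (6 * real N / pi\<^sup>2) powr (1/4) \<le> x}"
    unfolding cdf_def2 rank_distr_def by (subst measure_distr) (auto simp: vimage_def)
  also have "\<dots> = real (card (Vd_set N \<inter> {c. real_of_int (rk c) / (6 * real N / pi\<^sup>2) powr (1/4) \<le> x})) / real (card (Vd_set N))"
    using finite_Vd_set Vd_set_nonempty by (intro measure_pmf_of_set)
  also have "Vd_set N \<inter> {c. real_of_int (rk c) / (6 * real N / pi\<^sup>2) powr (1/4) \<le> x} = {c\<in>Vd_set N. real_of_int (rk c) / (6 * real N / pi\<^sup>2) powr (1/4) \<le> x}"
    by auto
  finally show ?thesis by (simp add: Vd_def)
qed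

text \<open>The square of the scale is \<open>sqrt (6 N) / pi\<close>, the reciprocal of
  \<open>temp N\<close>, so dividing the rank by the scale amounts to using the angle
  \<open>x * sqrt (temp N)\<close>.\<close>

lemma char_rank_distr:
  assumes "0 < N"
  shows "char (rank_distr N) x = rank_char_sum N (x * sqrt (temp N)) / of_nat (Vd N)"
proof -
  define s where "s = (6 * real N / pi\<^sup>2) powr (1/4)"
  have s: "1 / s = sqrt (temp N)"
  proof -
    have "s\<^sup>2 = sqrt (6 * real N / pi\<^sup>2)"
      using assms by (simp add: s_def powr_power powr_half_sqrt)
    hence "s\<^sup>2 = 1 / temp N" by (simp add: temp_def real_sqrt_divide)
    hence "sqrt (temp N) = sqrt (1 / s\<^sup>2)" by simp
    also have "\<dots> = 1 / s" by (simp add: real_sqrt_divide s_def)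
    finally show ?thesis ..
  qed
  have "char (rank_distr N) x = (\<integral>c. iexp (x * (real_of_int (rk c) / s)) \<partial>measure_pmf (pmf_of_set (Vd_set N)))"
    unfolding char_def rank_distr_def s_def by (subst integral_distr) auto
  also have "\<dots> = (\<Sum>c\<in>Vd_set N. pmf (pmf_of_set (Vd_set N)) c *\<^sub>R iexp (x * (real_of_int (rk c) / s)))"
    using finite_Vd_set Vd_set_nonempty by (intro integral_measure_pmf) auto
  also have "\<dots> = (\<Sum>c\<in>Vd_set N. cis (x * sqrt (temp N) * real_of_int (rk c)) / of_nat (Vd N))"
  proof (intro sum.cong refl)
    fix c assume c: "c \<in> Vd_set N"
    have "x * (real_of_int (rk c) / s) = x * (1 / s) * real_of_int (rk c)" by simp
    thus "pmf (pmf_of_set (Vd_set N)) c *\<^sub>R iexp (x * (real_of_int (rk c) / s)) = cis (x * sqrt (temp N) * real_of_int (rk c)) / of_nat (Vd N)"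
      unfolding s using c finite_Vd_set Vd_set_nonempty
      by (simp add: Vd_def cis_conv_exp scaleR_conv_of_real)
  qed
  finally show ?thesis by (simp add: rank_char_sum_def sum_divide_distrib)
qed

theorem corollary1:
  fixes x :: real
  shows "(\<lambda>N::nat. real (card {c\<in>Vd_set N.
              real_of_int (rk c) / (6 * real N / pi\<^sup>2) powr (1/4) \<le> x})
            / real (Vd N))
         \<longlonglongrightarrow> (1 / sqrt (2 * pi)) * integral {..x} (\<lambda>t. exp (- (t\<^sup>2) / 2))"
proof -
  have "weak_conv_m rank_distr std_normal_distribution"
  proof (rule levy_continuity[OF real_distribution_rank_distr real_dist_normal_dist])
    fix y :: real
    have "\<forall>\<^sub>F N in sequentially. rank_char_sum N (y * sqrt (temp N)) / of_nat (Vd N) = char (rank_distr N) y"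
      using char_rank_distr by (intro eventually_sequentiallyI[of 1]) simp
    with rank_char_tendsto have "(\<lambda>N. char (rank_distr N) y) \<longlonglongrightarrow> of_real (exp (- y\<^sup>2 / 2))"
      by (rule Lim_transform_eventually)
    thus "(\<lambda>N. char (rank_distr N) y) \<longlonglongrightarrow> char std_normal_distribution y"
      by (simp add: char_std_normal_distribution)
  qed
  hence "(\<lambda>N. cdf (rank_distr N) x) \<longlonglongrightarrow> cdf std_normal_distribution x"
    using isCont_cdf_std_normal unfolding weak_conv_m_def weak_conv_def by blast
  thus ?thesis unfolding cdf_rank_distr cdf_std_normal .
qed

end
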